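(* Let $(g,c,n)$ be a v-admissible triplet of integers with $3\le g\le c\le n$, and let $r$ be a positive integer. Let $G_1,G_2\in\mathcal{G}(g,c,n)$ have $m_1,m_2$ edges respectively, with $\delta(G_1)=A(g,c,n)$ and $\delta(G_2)=B(g,c,n)$. Then $$A(rg,rc,n_1)\le rA(g,c,n)\le rB(g,c,n)\le B(rg,rc,n_2)$$ for every integer $n_1\ge n+(r-1)m_1$ and every integer $n_2\ge n+(r-1)m_2$.
   Context: All graphs are finite, simple and connected. A graph $G$ is regarded as a geodesic metric space by identifying each edge isometrically with $[0,1]$; points are vertices and interior points of edges, $d$ is the shortest-path length. A geodesic triangle $T=\{x,y,z\}$ is a union of three geodesics $[xy],[yz],[zx]$; $\delta(T)$ is the infimum of $\delta\ge0$ such that each side lies in the $\delta$-neighbourhood of the union of the other two; $\delta(G)=\sup_T\delta(T)$ over geodesic triangles. Girth / circumference: length of a shortest / longest cycle. $\mathcal{G}(g,c,n)$ is the set of graphs with girth $g$, circumference $c$ and $n$ vertices; $A(g,c,n)=\min\{\delta(G):G\in\mathcal{G}(g,c,n)\}$, $B(g,c,n)=\max\{\delta(G):G\in\mathcal{G}(g,c,n)\}$. A triplet $(g,c,n)$ is v-admissible if $\mathcal{G}(g,c,n)\ne\emptyset$. *)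

theory Defs
  imports Complex_Main "HOL-Library.Extended_Nat"
begin

subsection \<open>Finite simple connected graphs\<close>

record 'a sgraph =
  verts :: "'a set"
  edges :: "'a set set"

definition simple_graph :: "'a sgraph \<Rightarrow> bool" where
  "simple_graph G \<longleftrightarrow> finite (verts G) \<and>
     edges G \<subseteq> {{u, v} | u v. u \<in> verts G \<and> v \<in> verts G \<and> u \<noteq> v}"

definition connected_graph :: "'a sgraph \<Rightarrow> bool" where
  "connected_graph G \<longleftrightarrow> verts G \<noteq> {} \<and>
     (\<forall>u\<in>verts G. \<forall>v\<in>verts G. (u, v) \<in> {(a, b). {a, b} \<in> edges G}\<^sup>*)"

text \<open>A cycle is listed by its vertices without repeating the first one, so its length is the
  length of the list.\<close>

definition is_cycle :: "'a sgraph \<Rightarrow> 'a list \<Rightarrow> bool" where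
  "is_cycle G vs \<longleftrightarrow> 3 \<le> length vs \<and> distinct vs \<and>
     (\<forall>i<length vs. {vs ! i, vs ! (Suc i mod length vs)} \<in> edges G)"

text \<open>Extended naturals keep acyclic graphs apart: they have girth \<open>\<infinity>\<close> and circumference \<open>0\<close>.\<close>

definition girth :: "'a sgraph \<Rightarrow> enat" where
  "girth G = Inf {enat (length vs) | vs. is_cycle G vs}"

definition circumference :: "'a sgraph \<Rightarrow> enat" where
  "circumference G = Sup {enat (length vs) | vs. is_cycle G vs}"


subsection \<open>The metric graph\<close>

text \<open>Points of the metric graph are given by barycentric coordinates: the point of the edge
  \<open>{u, v}\<close> at distance \<open>t\<close> from \<open>u\<close> is the function with value \<open>1 - t\<close> at \<open>u\<close>, \<open>t\<close> at \<open>v\<close> and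
  \<open>0\<close> elsewhere; the vertex \<open>v\<close> is the indicator function of \<open>{v}\<close>.  Thus points of different
  edges are identified exactly at common end vertices.\<close>

definition cell :: "'a set \<Rightarrow> ('a \<Rightarrow> real) set" where
  "cell S = {p. (\<forall>x. 0 \<le> p x) \<and> (\<forall>x. x \<notin> S \<longrightarrow> p x = 0) \<and> (\<Sum>x\<in>S. p x) = 1}"

definition points :: "'a sgraph \<Rightarrow> ('a \<Rightarrow> real) set" where
  "points G = (\<Union>v\<in>verts G. cell {v}) \<union> (\<Union>e\<in>edges G. cell e)"

text \<open>For \<open>p, q\<close> on a common edge \<open>{u, v}\<close> both nonzero summands equal \<open>\<bar>p u - q u\<bar>\<close>, so this is
  the distance of \<open>p\<close> and \<open>q\<close> under the identification of the edge with \<open>[0, 1]\<close>.\<close>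

definition seg_length :: "'a sgraph \<Rightarrow> ('a \<Rightarrow> real) \<Rightarrow> ('a \<Rightarrow> real) \<Rightarrow> real" where
  "seg_length G p q = (\<Sum>x\<in>verts G. \<bar>p x - q x\<bar>) / 2"

definition is_path ::
  "'a sgraph \<Rightarrow> ('a \<Rightarrow> real) \<Rightarrow> ('a \<Rightarrow> real) \<Rightarrow> ('a \<Rightarrow> real) list \<Rightarrow> bool" where
  "is_path G p q ps \<longleftrightarrow> ps \<noteq> [] \<and> hd ps = p \<and> last ps = q \<and> set ps \<subseteq> points G \<and>
     (\<forall>i<length ps - 1. \<exists>e\<in>edges G. ps ! i \<in> cell e \<and> ps ! Suc i \<in> cell e)"

definition path_length :: "'a sgraph \<Rightarrow> ('a \<Rightarrow> real) list \<Rightarrow> real" where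
  "path_length G ps = (\<Sum>i<length ps - 1. seg_length G (ps ! i) (ps ! Suc i))"

definition gdist :: "'a sgraph \<Rightarrow> ('a \<Rightarrow> real) \<Rightarrow> ('a \<Rightarrow> real) \<Rightarrow> real" where
  "gdist G p q = Inf {path_length G ps | ps. is_path G p q ps}"


subsection \<open>Hyperbolicity constant\<close>

definition geodesic_segment ::
  "'p set \<Rightarrow> ('p \<Rightarrow> 'p \<Rightarrow> real) \<Rightarrow> 'p \<Rightarrow> 'p \<Rightarrow> 'p set \<Rightarrow> bool" where
  "geodesic_segment M d x y S \<longleftrightarrow>
     (\<exists>\<gamma>. \<gamma> 0 = x \<and> \<gamma> (d x y) = y \<and> \<gamma> ` {0..d x y} = S \<and> S \<subseteq> M \<and>
          (\<forall>s\<in>{0..d x y}. \<forall>t\<in>{0..d x y}. d (\<gamma> s) (\<gamma> t) = \<bar>s - t\<bar>))"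

definition geodesic_triangle ::
  "'p set \<Rightarrow> ('p \<Rightarrow> 'p \<Rightarrow> real) \<Rightarrow> 'p set \<Rightarrow> 'p set \<Rightarrow> 'p set \<Rightarrow> bool" where
  "geodesic_triangle M d S1 S2 S3 \<longleftrightarrow>
     (\<exists>x\<in>M. \<exists>y\<in>M. \<exists>z\<in>M. geodesic_segment M d x y S1 \<and>
        geodesic_segment M d y z S2 \<and> geodesic_segment M d z x S3)"

definition nbhd :: "'p set \<Rightarrow> ('p \<Rightarrow> 'p \<Rightarrow> real) \<Rightarrow> real \<Rightarrow> 'p set \<Rightarrow> 'p set" where
  "nbhd M d \<epsilon> S = {p \<in> M. \<exists>q\<in>S. d p q \<le> \<epsilon>}"

definition triangle_delta ::
  "'p set \<Rightarrow> ('p \<Rightarrow> 'p \<Rightarrow> real) \<Rightarrow> 'p set \<Rightarrow> 'p set \<Rightarrow> 'p set \<Rightarrow> real" where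
  "triangle_delta M d S1 S2 S3 =
     Inf {\<epsilon>. 0 \<le> \<epsilon> \<and> S1 \<subseteq> nbhd M d \<epsilon> (S2 \<union> S3) \<and>
             S2 \<subseteq> nbhd M d \<epsilon> (S3 \<union> S1) \<and> S3 \<subseteq> nbhd M d \<epsilon> (S1 \<union> S2)}"

text \<open>Real-valued \<open>Sup\<close>: meaningful for bounded spaces, such as the metric graph of a finite
  connected graph, where all \<open>triangle_delta\<close> are at most the diameter.\<close>

definition hyp_const :: "'p set \<Rightarrow> ('p \<Rightarrow> 'p \<Rightarrow> real) \<Rightarrow> real" where
  "hyp_const M d =
     Sup {triangle_delta M d S1 S2 S3 | S1 S2 S3. geodesic_triangle M d S1 S2 S3}"

definition graph_delta :: "'a sgraph \<Rightarrow> real" where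
  "graph_delta G = hyp_const (points G) (gdist G)"


subsection \<open>Graphs with given girth, circumference and order\<close>

text \<open>Vertices are natural numbers, which covers every finite graph up to isomorphism.  The vertex
  set is otherwise arbitrary, so the class may be infinite, but it contains only finitely many
  isomorphism types; hence the sets under \<open>Min\<close> and \<open>Max\<close> below are finite.\<close>

definition graph_class :: "nat \<Rightarrow> nat \<Rightarrow> nat \<Rightarrow> nat sgraph set" where
  "graph_class g c n =
     {G. simple_graph G \<and> connected_graph G \<and> girth G = enat g \<and>
         circumference G = enat c \<and> card (verts G) = n}"

definition v_admissible :: "nat \<Rightarrow> nat \<Rightarrow> nat \<Rightarrow> bool" where
  "v_admissible g c n \<longleftrightarrow> graph_class g c n \<noteq> {}"

definition min_delta :: "nat \<Rightarrow> nat \<Rightarrow> nat \<Rightarrow> real" where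
  "min_delta g c n = Min (graph_delta ` graph_class g c n)"

definition max_delta :: "nat \<Rightarrow> nat \<Rightarrow> nat \<Rightarrow> real" where
  "max_delta g c n = Max (graph_delta ` graph_class g c n)"

end

theory Submission
  imports Defs
begin

text \<open>Subdividing every edge of \<open>G\<close> into \<open>r\<close> edges multiplies all cycle lengths and all distances in the
  metric graph by \<open>r\<close>, hence also the hyperbolicity constant; the subdivision has
  \<open>n + (r - 1) m\<close> vertices.  Further vertices are added one at a time as pendant vertices.  This
  creates no cycle, and it does not change the hyperbolicity constant either: the retraction that
  collapses the new edge maps geodesics to geodesics, and what a geodesic triangle covers of the new
  edge is covered twice.\<close>

subsection \<open>Comparing hyperbolicity constants\<close>

text \<open>No hyperbolicity constant is ever computed. All comparisons go through
  \<open>hyp_const_le_scaled\<close>, which only asks that each triangle of one space be matched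
  with a triangle of the other whose thinness carries over; similarities, isometric inclusions and
  the pendant retraction are instances. Matching needs exact distances, although a distance is an
  infimum over paths. Upper bounds come from explicit paths, lower bounds from the maximality of the
  path metric, so that conditions have to be checked on single edges only. Both outer inequalities
  of the theorem follow from one existence statement, \<open>graph_class_subdivide\<close>. Since
  pendant vertices fill any gap up to the prescribed order, an upper bound for the order of the
  subdivision suffices. Its vertices are points of a metric graph rather than numbers, which is why
  constants and cycle lengths are also shown invariant under relabelling. Relabelling onto an
  initial segment of the naturals serves a second time, to show that \<open>Min\<close> and
  \<open>Max\<close> range over finite sets.\<close>

definition thin_triangle ::
  "'p set \<Rightarrow> ('p \<Rightarrow> 'p \<Rightarrow> real) \<Rightarrow> real \<Rightarrow> 'p set \<Rightarrow> 'p set \<Rightarrow> 'p set \<Rightarrow> bool" where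
  "thin_triangle M d \<epsilon> S1 S2 S3 \<longleftrightarrow> 0 \<le> \<epsilon> \<and> S1 \<subseteq> nbhd M d \<epsilon> (S2 \<union> S3) \<and>
     S2 \<subseteq> nbhd M d \<epsilon> (S3 \<union> S1) \<and> S3 \<subseteq> nbhd M d \<epsilon> (S1 \<union> S2)"

text \<open>With thinness as a predicate in \<open>\<epsilon>\<close>, it can be carried from one
  triangle to another for each \<open>\<epsilon>\<close> separately, before any infimum is
  taken.\<close>

lemma triangle_delta_thin: "triangle_delta M d S1 S2 S3 = Inf {\<epsilon>. thin_triangle M d \<epsilon> S1 S2 S3}"
  by (simp only: triangle_delta_def thin_triangle_def)

lemma geodesic_segmentE:
  assumes "geodesic_segment M d x y S"
  obtains \<gamma> where "\<gamma> 0 = x" "\<gamma> (d x y) = y" "\<gamma> ` {0..d x y} = S" "S \<subseteq> M"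
    "\<forall>s\<in>{0..d x y}. \<forall>t\<in>{0..d x y}. d (\<gamma> s) (\<gamma> t) = \<bar>s - t\<bar>"
  using assms unfolding geodesic_segment_def by (elim exE conjE) (rule that)

lemma geodesic_segment_subset: "geodesic_segment M d x y S \<Longrightarrow> S \<subseteq> M"
  by (erule geodesic_segmentE)

lemma geodesic_segment_endpoints:
  assumes "geodesic_segment M d x y S" "0 \<le> d x y"
  shows "x \<in> S" "y \<in> S"
proof -
  obtain \<gamma> where \<gamma>: "\<gamma> 0 = x" "\<gamma> (d x y) = y" "\<gamma> ` {0..d x y} = S"
    by (rule geodesic_segmentE[OF assms(1)])
  show "x \<in> S" using imageI[of 0 "{0..d x y}" \<gamma>] \<gamma> assms(2) by simp
  show "y \<in> S" using imageI[of "d x y" "{0..d x y}" \<gamma>] \<gamma> assms(2) by simp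
qed

lemma geodesic_segment_refl: "x \<in> M \<Longrightarrow> d x x = 0 \<Longrightarrow> geodesic_segment M d x x {x}"
  unfolding geodesic_segment_def by (rule exI[of _ "\<lambda>_. x"]) auto

lemma geodesic_segment_sym:
  assumes "geodesic_segment M d x y S" "d y x = d x y"
  shows "geodesic_segment M d y x S"
proof -
  obtain \<gamma> where \<gamma>: "\<gamma> 0 = x" "\<gamma> (d x y) = y" "\<gamma> ` {0..d x y} = S" "S \<subseteq> M"
    "\<forall>s\<in>{0..d x y}. \<forall>t\<in>{0..d x y}. d (\<gamma> s) (\<gamma> t) = \<bar>s - t\<bar>"
    by (rule geodesic_segmentE[OF assms(1)])
  have "(\<lambda>t. \<gamma> (d x y - t)) ` {0..d x y} = \<gamma> ` ((\<lambda>t. d x y - t) ` {0..d x y})"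
    by (simp only: image_image)
  also have "(\<lambda>t. d x y - t) ` {0..d x y} = {0..d x y}" by simp
  finally have "(\<lambda>t. \<gamma> (d x y - t)) ` {0..d x y} = S" using \<gamma>(3) by simp
  then show ?thesis
    unfolding geodesic_segment_def assms(2) using \<gamma>
    by (intro exI[of _ "\<lambda>t. \<gamma> (d x y - t)"]) auto
qed

lemma geodesic_triangleE:
  assumes "geodesic_triangle M d S1 S2 S3"
  obtains x y z where "x \<in> M" "y \<in> M" "z \<in> M" "geodesic_segment M d x y S1"
    "geodesic_segment M d y z S2" "geodesic_segment M d z x S3"
  using assms unfolding geodesic_triangle_def by (elim bexE conjE)

lemma geodesic_triangleI:
  assumes "x \<in> M" "y \<in> M" "z \<in> M" "geodesic_segment M d x y S1"
    "geodesic_segment M d y z S2" "geodesic_segment M d z x S3"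
  shows "geodesic_triangle M d S1 S2 S3"
  unfolding geodesic_triangle_def using assms by (intro bexI conjI)

text \<open>Each side contains a corner, so every point has a point of the other two sides within
  the diameter. This keeps the set under the infimum nonempty.\<close>

lemma thin_triangle_diameter:
  assumes tri: "geodesic_triangle M d S1 S2 S3"
    and nonneg: "\<And>x y. x \<in> M \<Longrightarrow> y \<in> M \<Longrightarrow> 0 \<le> d x y"
    and bound: "\<And>x y. x \<in> M \<Longrightarrow> y \<in> M \<Longrightarrow> d x y \<le> K"
  shows "thin_triangle M d K S1 S2 S3"
proof -
  obtain x y z where xyz: "x \<in> M" "y \<in> M" "z \<in> M" and
    g: "geodesic_segment M d x y S1" "geodesic_segment M d y z S2" "geodesic_segment M d z x S3"
    by (rule geodesic_triangleE[OF tri])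
  have mem: "x \<in> S1" "y \<in> S2" "z \<in> S3"
    using g xyz nonneg geodesic_segment_endpoints(1) by metis+
  note sub = g[THEN geodesic_segment_subset]
  have "0 \<le> K" using nonneg bound xyz(1) order_trans by blast
  then show ?thesis unfolding thin_triangle_def nbhd_def using mem sub bound by blast
qed

text \<open>Thinness transfers for every \<open>\<epsilon>\<close>, hence the bound passes to the
  infimum for each triangle and then to the supremum over triangles. On the reals,
  \<open>Inf\<close> and \<open>Sup\<close> are meaningful only for nonempty bounded sets:
  \<open>K\<close> bounds the constants of the triangles in \<open>M\<close>, and
  \<open>base\<close> provides a triangle in \<open>M'\<close>.\<close>

lemma hyp_const_le_scaled:
  assumes ne: "base \<in> M'" "d' base base = 0" and s: "0 < s"
    and nonneg: "\<And>x y. x \<in> M \<Longrightarrow> y \<in> M \<Longrightarrow> 0 \<le> d x y"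
    and bound: "\<And>x y. x \<in> M \<Longrightarrow> y \<in> M \<Longrightarrow> d x y \<le> K"
    and tri: "\<And>S1 S2 S3. geodesic_triangle M' d' S1 S2 S3 \<Longrightarrow>
       \<exists>T1 T2 T3. geodesic_triangle M d T1 T2 T3 \<and>
         (\<forall>\<epsilon>. thin_triangle M d \<epsilon> T1 T2 T3 \<longrightarrow> thin_triangle M' d' (s * \<epsilon>) S1 S2 S3)"
  shows "hyp_const M' d' \<le> s * hyp_const M d"
proof -
  have bdd: "bdd_below {\<epsilon>. thin_triangle N e \<epsilon> S1 S2 S3}" for N and e :: "'c \<Rightarrow> 'c \<Rightarrow> real" and S1 S2 S3
    unfolding thin_triangle_def bdd_below_def by blast
  have thinK: "thin_triangle M d K S1 S2 S3" if "geodesic_triangle M d S1 S2 S3" for S1 S2 S3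
    using thin_triangle_diameter[OF that] nonneg bound by blast
  have "triangle_delta M d S1 S2 S3 \<le> K" if "geodesic_triangle M d S1 S2 S3" for S1 S2 S3
    unfolding triangle_delta_thin by (rule cInf_lower[OF _ bdd]) (simp add: thinK that)
  then have bddS: "bdd_above {triangle_delta M d S1 S2 S3 | S1 S2 S3. geodesic_triangle M d S1 S2 S3}"
    unfolding bdd_above_def by blast
  have "triangle_delta M' d' S1 S2 S3 \<le> s * hyp_const M d"
    if S: "geodesic_triangle M' d' S1 S2 S3" for S1 S2 S3
  proof -
    obtain T1 T2 T3 where T: "geodesic_triangle M d T1 T2 T3"
      "\<And>\<epsilon>. thin_triangle M d \<epsilon> T1 T2 T3 \<Longrightarrow> thin_triangle M' d' (s * \<epsilon>) S1 S2 S3"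
      using tri[OF S] by blast
    have "triangle_delta M' d' S1 S2 S3 / s \<le> triangle_delta M d T1 T2 T3"
      unfolding triangle_delta_thin[of M]
    proof (rule cInf_greatest)
      show "{\<epsilon>. thin_triangle M d \<epsilon> T1 T2 T3} \<noteq> {}" using thinK[OF T(1)] by blast
      fix \<epsilon> assume "\<epsilon> \<in> {\<epsilon>. thin_triangle M d \<epsilon> T1 T2 T3}"
      then have "triangle_delta M' d' S1 S2 S3 \<le> s * \<epsilon>"
        unfolding triangle_delta_thin using T(2) by (intro cInf_lower[OF _ bdd]) simp
      then show "triangle_delta M' d' S1 S2 S3 / s \<le> \<epsilon>" using s by (simp add: divide_le_eq mult.commute)
    qed
    also have "\<dots> \<le> hyp_const M d"
      unfolding hyp_const_def by (rule cSup_upper[OF _ bddS]) (use T(1) in blast)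
    finally show ?thesis using s by (simp add: divide_le_eq mult.commute)
  qed
  note le = this
  \<comment> \<open>The degenerate triangle at \<open>base\<close> makes the set under the supremum
    for \<open>M'\<close> nonempty.\<close>
  have "geodesic_triangle M' d' {base} {base} {base}"
    using geodesic_segment_refl[of base M' d', OF ne] ne(1) by (intro geodesic_triangleI)
  then have ne': "{triangle_delta M' d' S1 S2 S3 | S1 S2 S3. geodesic_triangle M' d' S1 S2 S3} \<noteq> {}"
    by blast
  show ?thesis
    unfolding hyp_const_def[of M' d']
  proof (rule cSup_least[OF ne'])
    fix t assume "t \<in> {triangle_delta M' d' S1 S2 S3 | S1 S2 S3. geodesic_triangle M' d' S1 S2 S3}"
    then obtain S1 S2 S3 where "geodesic_triangle M' d' S1 S2 S3" "t = triangle_delta M' d' S1 S2 S3"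
      by blast
    then show "t \<le> s * hyp_const M d" using le by simp
  qed
qed

section \<open>Similarities between metric spaces\<close>

lemma geodesic_segment_scale:
  assumes seg: "geodesic_segment M d x y S" and xy: "x \<in> M" "y \<in> M" and s: "0 < s"
    and into: "\<Phi> ` M \<subseteq> M'"
    and dist: "\<And>p q. p \<in> M \<Longrightarrow> q \<in> M \<Longrightarrow> d' (\<Phi> p) (\<Phi> q) = s * d p q"
  shows "geodesic_segment M' d' (\<Phi> x) (\<Phi> y) (\<Phi> ` S)"
proof -
  obtain \<gamma> where \<gamma>: "\<gamma> 0 = x" "\<gamma> (d x y) = y" "\<gamma> ` {0..d x y} = S" "S \<subseteq> M"
    "\<forall>s\<in>{0..d x y}. \<forall>t\<in>{0..d x y}. d (\<gamma> s) (\<gamma> t) = \<bar>s - t\<bar>"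
    by (rule geodesic_segmentE[OF seg])
  have len: "d' (\<Phi> x) (\<Phi> y) = s * d x y" using dist xy by simp
  \<comment> \<open>The image of the geodesic has speed \<open>s\<close>; the parameter
    \<open>t / s\<close> restores unit speed.\<close>
  have dom: "t / s \<in> {0..d x y}" if "t \<in> {0..s * d x y}" for t
    using that s by (simp add: divide_le_eq mult.commute)
  have "(\<lambda>t. t / s) ` {0..s * d x y} = {0..d x y}"
  proof
    show "(\<lambda>t. t / s) ` {0..s * d x y} \<subseteq> {0..d x y}" using dom by blast
    show "{0..d x y} \<subseteq> (\<lambda>t. t / s) ` {0..s * d x y}"
    proof
      fix t assume "t \<in> {0..d x y}"
      then have "s * t \<in> {0..s * d x y}" "t = (s * t) / s" using s by simp_all
      then show "t \<in> (\<lambda>t. t / s) ` {0..s * d x y}" by blast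
    qed
  qed
  then have img: "(\<lambda>t. \<Phi> (\<gamma> (t / s))) ` {0..s * d x y} = \<Phi> ` S"
    unfolding \<gamma>(3)[symmetric] by (simp only: image_image flip: \<open>(\<lambda>t. t / s) ` {0..s * d x y} = {0..d x y}\<close>)
  have iso: "d' (\<Phi> (\<gamma> (a / s))) (\<Phi> (\<gamma> (b / s))) = \<bar>a - b\<bar>"
    if "a \<in> {0..s * d x y}" "b \<in> {0..s * d x y}" for a b
  proof -
    have "\<gamma> (a / s) \<in> M" "\<gamma> (b / s) \<in> M" using \<gamma>(3,4) dom that by blast+
    then have "d' (\<Phi> (\<gamma> (a / s))) (\<Phi> (\<gamma> (b / s))) = s * \<bar>a / s - b / s\<bar>"
      using dist \<gamma>(5) dom that by simp
    also have "\<dots> = \<bar>a - b\<bar>" using s by (simp flip: diff_divide_distrib)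
    finally show ?thesis .
  qed
  have "\<Phi> ` S \<subseteq> M'" using into \<gamma>(4) by blast
  then show ?thesis
    unfolding geodesic_segment_def len using img iso \<gamma>(1,2) s
    by (intro exI[of _ "\<lambda>t. \<Phi> (\<gamma> (t / s))"]) auto
qed

lemma nbhd_image_scale:
  assumes "A \<subseteq> nbhd M d \<epsilon> B" "B \<subseteq> M" "\<Phi> ` M \<subseteq> M'" "0 < s"
    and "\<And>p q. p \<in> M \<Longrightarrow> q \<in> M \<Longrightarrow> d' (\<Phi> p) (\<Phi> q) = s * d p q"
  shows "\<Phi> ` A \<subseteq> nbhd M' d' (s * \<epsilon>) (\<Phi> ` B)"
proof
  fix P assume "P \<in> \<Phi> ` A"
  then obtain p where p: "p \<in> A" "P = \<Phi> p" by blast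
  then obtain q where q: "q \<in> B" "d p q \<le> \<epsilon>" "p \<in> M" using assms(1) unfolding nbhd_def by blast
  have "q \<in> M" using q(1) assms(2) by blast
  then have "d' (\<Phi> p) (\<Phi> q) \<le> s * \<epsilon>" using assms(5)[OF q(3)] q(2) assms(4) by simp
  then show "P \<in> nbhd M' d' (s * \<epsilon>) (\<Phi> ` B)"
    unfolding nbhd_def using p q assms(3) by blast
qed

text \<open>Triangles are pulled back along \<open>\<Psi>\<close>, which scales distances by
  \<open>1 / s\<close> because \<open>\<Phi>\<close> scales them by \<open>s\<close> and undoes
  \<open>\<Psi>\<close>; thinness is then pushed forward along \<open>\<Phi>\<close>.\<close>

lemma hyp_const_le_similar:
  assumes ne: "base \<in> M'" "d' base base = 0" and s: "0 < s"
    and nonneg: "\<And>x y. x \<in> M \<Longrightarrow> y \<in> M \<Longrightarrow> 0 \<le> d x y"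
    and bound: "\<And>x y. x \<in> M \<Longrightarrow> y \<in> M \<Longrightarrow> d x y \<le> K"
    and into: "\<Phi> ` M \<subseteq> M'" "\<Psi> ` M' \<subseteq> M" and inv: "\<And>p. p \<in> M' \<Longrightarrow> \<Phi> (\<Psi> p) = p"
    and dist: "\<And>p q. p \<in> M \<Longrightarrow> q \<in> M \<Longrightarrow> d' (\<Phi> p) (\<Phi> q) = s * d p q"
  shows "hyp_const M' d' \<le> s * hyp_const M d"
proof (rule hyp_const_le_scaled[where base = base and s = s and d = d and d' = d' and M = M and K = K])
  fix S1 S2 S3 assume "geodesic_triangle M' d' S1 S2 S3"
  then obtain x y z where xyz: "x \<in> M'" "y \<in> M'" "z \<in> M'" and
    g: "geodesic_segment M' d' x y S1" "geodesic_segment M' d' y z S2" "geodesic_segment M' d' z x S3"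
    by (rule geodesic_triangleE)
  note sub = g[THEN geodesic_segment_subset]
  have dist': "d (\<Psi> p) (\<Psi> q) = (1 / s) * d' p q" if "p \<in> M'" "q \<in> M'" for p q
  proof -
    have "\<Psi> p \<in> M" "\<Psi> q \<in> M" using into(2) that by auto
    then have "d' p q = s * d (\<Psi> p) (\<Psi> q)" using dist inv that by metis
    then show ?thesis using s by simp
  qed
  have s': "0 < 1 / s" using s by simp
  have "geodesic_triangle M d (\<Psi> ` S1) (\<Psi> ` S2) (\<Psi> ` S3)"
    using geodesic_segment_scale[OF g(1) xyz(1,2) s' into(2) dist']
      geodesic_segment_scale[OF g(2) xyz(2,3) s' into(2) dist']
      geodesic_segment_scale[OF g(3) xyz(3,1) s' into(2) dist'] into(2) xyz
    by (intro geodesic_triangleI[of "\<Psi> x" _ "\<Psi> y" "\<Psi> z"]) auto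
  moreover have "thin_triangle M' d' (s * \<epsilon>) S1 S2 S3"
    if "thin_triangle M d \<epsilon> (\<Psi> ` S1) (\<Psi> ` S2) (\<Psi> ` S3)" for \<epsilon>
  proof -
    have "\<Phi> ` \<Psi> ` S = S" if "S \<subseteq> M'" for S
    proof -
      have "\<Phi> ` \<Psi> ` S = (\<lambda>p. p) ` S"
        unfolding image_image by (rule image_cong) (use that inv in auto)
      then show ?thesis by simp
    qed
    then have eq: "\<Phi> ` \<Psi> ` S1 = S1" "\<Phi> ` \<Psi> ` S2 = S2" "\<Phi> ` \<Psi> ` S3 = S3" using sub by auto
    have sub': "\<Psi> ` S1 \<subseteq> M" "\<Psi> ` S2 \<subseteq> M" "\<Psi> ` S3 \<subseteq> M" using sub into(2) by blast+
    have *: "C \<subseteq> nbhd M' d' (s * \<epsilon>) (A \<union> B)"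
      if "\<Psi> ` C \<subseteq> nbhd M d \<epsilon> (\<Psi> ` A \<union> \<Psi> ` B)" "\<Psi> ` A \<subseteq> M" "\<Psi> ` B \<subseteq> M"
        "\<Phi> ` \<Psi> ` A = A" "\<Phi> ` \<Psi> ` B = B" "\<Phi> ` \<Psi> ` C = C" for A B C
    proof -
      have "\<Phi> ` \<Psi> ` C \<subseteq> nbhd M' d' (s * \<epsilon>) (\<Phi> ` (\<Psi> ` A \<union> \<Psi> ` B))"
        by (rule nbhd_image_scale[OF that(1) _ into(1) s dist]) (use that in auto)
      then show ?thesis using that by (simp add: image_Un)
    qed
    have t: "0 \<le> \<epsilon>" "\<Psi> ` S1 \<subseteq> nbhd M d \<epsilon> (\<Psi> ` S2 \<union> \<Psi> ` S3)"
      "\<Psi> ` S2 \<subseteq> nbhd M d \<epsilon> (\<Psi> ` S3 \<union> \<Psi> ` S1)" "\<Psi> ` S3 \<subseteq> nbhd M d \<epsilon> (\<Psi> ` S1 \<union> \<Psi> ` S2)"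
      using that unfolding thin_triangle_def by simp_all
    show ?thesis
      unfolding thin_triangle_def
      using *[OF t(2) sub'(2,3) eq(2,3,1)] *[OF t(3) sub'(3,1) eq(3,1,2)] *[OF t(4) sub'(1,2) eq(1,2,3)] t(1) s
      by simp
  qed
  ultimately show "\<exists>T1 T2 T3. geodesic_triangle M d T1 T2 T3 \<and>
         (\<forall>\<epsilon>. thin_triangle M d \<epsilon> T1 T2 T3 \<longrightarrow> thin_triangle M' d' (s * \<epsilon>) S1 S2 S3)" by blast
qed (fact ne s nonneg bound)+

subsection \<open>The path metric\<close>

lemma seg_length_nonneg: "0 \<le> seg_length G p q"
  unfolding seg_length_def by (simp add: sum_nonneg)

lemma seg_length_refl [simp]: "seg_length G p p = 0"
  unfolding seg_length_def by simp

lemma seg_length_sym: "seg_length G p q = seg_length G q p"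
  unfolding seg_length_def by (simp add: abs_minus_commute)

lemma seg_length_triangle: "seg_length G p s \<le> seg_length G p q + seg_length G q s"
  unfolding seg_length_def add_divide_distrib[symmetric] sum.distrib[symmetric]
  by (intro divide_right_mono sum_mono) auto

text \<open>Paths together with their accumulated length, as a predicate that grows at the end
  point: concatenation and reversal become rule inductions instead of index computations in
  lists.\<close>

inductive walk :: "'a sgraph \<Rightarrow> ('a \<Rightarrow> real) \<Rightarrow> ('a \<Rightarrow> real) \<Rightarrow> real \<Rightarrow> bool" for G p where
  refl: "p \<in> points G \<Longrightarrow> walk G p p 0"
| step: "walk G p q l \<Longrightarrow> e \<in> edges G \<Longrightarrow> q \<in> cell e \<Longrightarrow> s \<in> cell e \<Longrightarrow>
    walk G p s (l + seg_length G q s)"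

lemma cell_subset_points: "e \<in> edges G \<Longrightarrow> cell e \<subseteq> points G"
  unfolding points_def by blast

lemma walk_points: "walk G p q l \<Longrightarrow> p \<in> points G \<and> q \<in> points G"
  by (induction rule: walk.induct) (use cell_subset_points in blast)+

lemma walk_nonneg: "walk G p q l \<Longrightarrow> 0 \<le> l"
  by (induction rule: walk.induct) (auto simp: seg_length_nonneg)

lemma walk_trans: "walk G q s m \<Longrightarrow> walk G p q l \<Longrightarrow> walk G p s (l + m)"
proof (induction rule: walk.induct)
  case (step t k e s)
  then show ?case using walk.step[of G p t "l + k" e s] by (simp add: add.assoc)
qed simp

lemma walk_edge: "e \<in> edges G \<Longrightarrow> p \<in> cell e \<Longrightarrow> q \<in> cell e \<Longrightarrow> walk G p q (seg_length G p q)"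
  using walk.step[OF walk.refl, of p G e q] cell_subset_points by force

lemma walk_sym: "walk G p q l \<Longrightarrow> walk G q p l"
proof (induction rule: walk.induct)
  case (step q l e s)
  then have "walk G s q (seg_length G s q)" by (intro walk_edge)
  from walk_trans[OF step.IH this] show ?case by (simp add: seg_length_sym add.commute)
qed (rule walk.refl)

lemma is_path_imp_walk: "is_path G p q ps \<Longrightarrow> walk G p q (path_length G ps)"
proof (induction ps arbitrary: q rule: rev_induct)
  case Nil
  then show ?case by (simp add: is_path_def)
next
  case (snoc s ps)
  show ?case
  proof (cases "ps = []")
    case True
    then show ?thesis using snoc.prems by (auto simp: is_path_def path_length_def intro: walk.refl)
  next
    case False
    then obtain k where k: "length ps = Suc k" by (cases ps) auto
    have nth: "(ps @ [s]) ! i = ps ! i" if "i \<le> k" for i using that k by (simp add: nth_append)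
    have last: "last ps = ps ! k" "(ps @ [s]) ! Suc k = s"
      using False k by (simp_all add: last_conv_nth nth_append)
    have edge: "\<exists>e\<in>edges G. (ps @ [s]) ! i \<in> cell e \<and> (ps @ [s]) ! Suc i \<in> cell e" if "i \<le> k" for i
    proof -
      have "\<forall>i<length (ps @ [s]) - 1. \<exists>e\<in>edges G. (ps @ [s]) ! i \<in> cell e \<and> (ps @ [s]) ! Suc i \<in> cell e"
        using snoc.prems unfolding is_path_def by (elim conjE)
      then show ?thesis using that k by (elim allE[of _ i]) simp
    qed
    have "is_path G p (ps ! k) ps"
      unfolding is_path_def
    proof (intro conjI allI impI)
      show "hd ps = p" "set ps \<subseteq> points G" using snoc.prems False by (auto simp: is_path_def)
      fix i assume "i < length ps - 1"
      then show "\<exists>e\<in>edges G. ps ! i \<in> cell e \<and> ps ! Suc i \<in> cell e"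
        using edge[of i] nth[of i] nth[of "Suc i"] k by simp
    qed (use False last in auto)
    then have "walk G p (ps ! k) (path_length G ps)" by (rule snoc.IH)
    moreover obtain e where "e \<in> edges G" "ps ! k \<in> cell e" "s \<in> cell e"
      using edge[of k] nth[of k] last by auto
    ultimately have "walk G p s (path_length G ps + seg_length G (ps ! k) s)" by (rule walk.step)
    moreover have "path_length G (ps @ [s]) = path_length G ps + seg_length G (ps ! k) s"
      unfolding path_length_def using k last nth
      by (auto simp: nth_append intro!: sum.cong)
    ultimately show ?thesis using snoc.prems by (simp add: is_path_def)
  qed
qed

lemma walk_imp_is_path: "walk G p q l \<Longrightarrow> \<exists>ps. is_path G p q ps \<and> path_length G ps = l"
proof (induction rule: walk.induct)
  case refl
  then show ?case by (intro exI[of _ "[p]"]) (simp add: is_path_def path_length_def)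
next
  case (step q l e s)
  then obtain ps where ps: "is_path G p q ps" "path_length G ps = l" by blast
  then obtain k where k: "length ps = Suc k" by (cases ps) (auto simp: is_path_def)
  then have ne: "ps \<noteq> []" by auto
  have q: "ps ! k = q" using ps(1) k ne by (simp add: is_path_def last_conv_nth)
  have "is_path G p s (ps @ [s])"
    unfolding is_path_def
  proof (intro conjI allI impI)
    show "hd (ps @ [s]) = p" "set (ps @ [s]) \<subseteq> points G"
      using ps(1) ne step.hyps(2,4) cell_subset_points[of e G] by (auto simp: is_path_def)
    fix i assume "i < length (ps @ [s]) - 1"
    then consider "i < k" | "i = k" using k by fastforce
    then show "\<exists>e\<in>edges G. (ps @ [s]) ! i \<in> cell e \<and> (ps @ [s]) ! Suc i \<in> cell e"
    proof cases
      case 1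
      then show ?thesis using ps(1) k by (simp add: is_path_def nth_append)
    next
      case 2
      then show ?thesis using step.hyps k q by (auto simp: nth_append)
    qed
  qed auto
  moreover have "path_length G (ps @ [s]) = l + seg_length G q s"
    using ps(2) k q unfolding path_length_def by (auto simp: nth_append intro!: sum.cong)
  ultimately show ?case by blast
qed

lemma gdist_walk: "gdist G p q = Inf {l. walk G p q l}"
  unfolding gdist_def
  by (rule arg_cong[of _ _ Inf]) (use is_path_imp_walk walk_imp_is_path in blast)

section \<open>Coordinates of vertices and edge points\<close>

definition vpt :: "'a \<Rightarrow> 'a \<Rightarrow> real" where
  "vpt v = (\<lambda>x. if x = v then 1 else 0)"

definition ept :: "'a \<Rightarrow> 'a \<Rightarrow> real \<Rightarrow> 'a \<Rightarrow> real" where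
  "ept u v t = (\<lambda>x. if x = u then 1 - t else if x = v then t else 0)"

lemma ept_0 [simp]: "ept u v 0 = vpt u"
  unfolding ept_def vpt_def by auto

lemma ept_1 [simp]: "u \<noteq> v \<Longrightarrow> ept u v 1 = vpt v"
  unfolding ept_def vpt_def by auto

lemma ept_sym: "u \<noteq> v \<Longrightarrow> ept v u t = ept u v (1 - t)"
  unfolding ept_def by auto

lemma cell_singleton: "cell {v} = {vpt v}"
proof -
  have "p = vpt v" if "p \<in> cell {v}" for p
    using that unfolding cell_def vpt_def by (auto simp: fun_eq_iff)
  moreover have "vpt v \<in> cell {v}" unfolding cell_def vpt_def by auto
  ultimately show ?thesis by blast
qed

lemma cell_edge: "u \<noteq> v \<Longrightarrow> cell {u, v} = ept u v ` {0..1}"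
proof -
  assume uv: "u \<noteq> v"
  have "p \<in> ept u v ` {0..1}" if "p \<in> cell {u, v}" for p
  proof -
    have p: "\<And>x. 0 \<le> p x" "\<And>x. x \<noteq> u \<Longrightarrow> x \<noteq> v \<Longrightarrow> p x = 0" "p u + p v = 1"
      using that uv unfolding cell_def by auto
    have "p = ept u v (p v)" using p uv unfolding ept_def by (auto simp: fun_eq_iff)
    moreover have "p v \<in> {0..1}" using p(1)[of u] p(1)[of v] p(3) by simp
    ultimately show ?thesis by blast
  qed
  moreover have "ept u v t \<in> cell {u, v}" if "t \<in> {0..1}" for t
    using that uv unfolding cell_def ept_def by auto
  ultimately show ?thesis by blast
qed

lemma ept_in_cell: "u \<noteq> v \<Longrightarrow> 0 \<le> t \<Longrightarrow> t \<le> 1 \<Longrightarrow> ept u v t \<in> cell {u, v}"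
  by (simp add: cell_edge)

section \<open>The metric space of a connected graph\<close>

locale metric_graph =
  fixes G :: "'a sgraph"
  assumes simple: "simple_graph G" and connected: "connected_graph G"
begin

lemma finite_verts [simp]: "finite (verts G)"
  using simple unfolding simple_graph_def by simp

lemma edgeE:
  assumes "e \<in> edges G"
  obtains u v where "e = {u, v}" "u \<in> verts G" "v \<in> verts G" "u \<noteq> v"
  using assms simple unfolding simple_graph_def by blast

lemma edge_verts:
  assumes "{u, v} \<in> edges G"
  shows "u \<in> verts G" "v \<in> verts G" "u \<noteq> v"
  using edgeE[OF assms] by (metis doubleton_eq_iff)+

lemma pointsE:
  assumes "p \<in> points G"
  obtains v where "v \<in> verts G" "p = vpt v"
  | u v t where "{u, v} \<in> edges G" "0 \<le> t" "t \<le> 1" "p = ept u v t"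
proof -
  consider v where "v \<in> verts G" "p \<in> cell {v}" | e where "e \<in> edges G" "p \<in> cell e"
    using assms unfolding points_def by blast
  then show ?thesis
  proof cases
    case 1
    then show ?thesis using that(1) by (simp add: cell_singleton)
  next
    case 2
    then show ?thesis using that(2) edgeE[OF 2(1)] cell_edge by (metis atLeastAtMost_iff imageE)
  qed
qed

lemma vpt_points: "v \<in> verts G \<Longrightarrow> vpt v \<in> points G"
  unfolding points_def by (auto simp: cell_singleton)

lemma ept_cell: "{u, v} \<in> edges G \<Longrightarrow> 0 \<le> t \<Longrightarrow> t \<le> 1 \<Longrightarrow> ept u v t \<in> cell {u, v}"
  by (rule ept_in_cell[OF edge_verts(3)])

lemma ept_points: "{u, v} \<in> edges G \<Longrightarrow> 0 \<le> t \<Longrightarrow> t \<le> 1 \<Longrightarrow> ept u v t \<in> points G"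
  by (rule subsetD[OF cell_subset_points ept_cell])

lemma points_cell:
  assumes "p \<in> points G"
  obtains S where "S \<subseteq> verts G" "p \<in> cell S"
proof -
  have sub: "e \<subseteq> verts G" if "e \<in> edges G" for e
    by (rule edgeE[OF that]) simp
  consider v where "v \<in> verts G" "p \<in> cell {v}" | e where "e \<in> edges G" "p \<in> cell e"
    using assms unfolding points_def by blast
  then show ?thesis by cases (use that sub in auto)
qed

lemma points_outside: "p \<in> points G \<Longrightarrow> x \<notin> verts G \<Longrightarrow> p x = 0"
  by (erule points_cell) (auto simp: cell_def)

lemma points_nonneg: "p \<in> points G \<Longrightarrow> 0 \<le> p x"
  by (erule points_cell) (simp add: cell_def)

lemma points_sum:
  assumes "p \<in> points G"
  shows "(\<Sum>x\<in>verts G. p x) = 1"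
proof -
  obtain S where S: "S \<subseteq> verts G" "p \<in> cell S" by (rule points_cell[OF assms])
  have "(\<Sum>x\<in>verts G. p x) = (\<Sum>x\<in>S. p x)"
    by (rule sum.mono_neutral_right) (use S in \<open>auto simp: cell_def\<close>)
  then show ?thesis using S(2) by (simp add: cell_def)
qed

lemma seg_length_ept:
  assumes "{u, v} \<in> edges G"
  shows "seg_length G (ept u v s) (ept u v t) = \<bar>s - t\<bar>"
proof -
  have "(\<Sum>x\<in>verts G. \<bar>ept u v s x - ept u v t x\<bar>) = (\<Sum>x\<in>{u, v}. \<bar>ept u v s x - ept u v t x\<bar>)"
    by (rule sum.mono_neutral_right) (use edge_verts[OF assms] in \<open>auto simp: ept_def\<close>)
  then show ?thesis using edge_verts(3)[OF assms] by (simp add: seg_length_def ept_def)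
qed

lemma walk_verts:
  assumes "u \<in> verts G" "v \<in> verts G"
  shows "\<exists>l. walk G (vpt u) (vpt v) l"
proof -
  have "(u, v) \<in> {(a, b). {a, b} \<in> edges G}\<^sup>*"
    using assms connected unfolding connected_graph_def by blast
  then show ?thesis
  proof (induction rule: rtrancl_induct)
    case base
    then show ?case using walk.refl vpt_points assms(1) by blast
  next
    case (step y z)
    then have e: "{y, z} \<in> edges G" by simp
    have "vpt y \<in> cell {y, z}" "vpt z \<in> cell {y, z}"
      using ept_cell[OF e, of 0] ept_cell[OF e, of 1] edge_verts[OF e] by simp_all
    then show ?case using step.IH walk.step[OF _ e] by blast
  qed
qed

lemma walk_to_vert:
  assumes "p \<in> points G"
  obtains v l where "v \<in> verts G" "l \<le> 1" "walk G p (vpt v) l"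
  using assms
proof (rule pointsE)
  fix v assume "v \<in> verts G" "p = vpt v"
  then show ?thesis using that[of v 0] walk.refl[OF assms] by simp
next
  fix u v t assume *: "{u, v} \<in> edges G" "0 \<le> t" "t \<le> 1" "p = ept u v t"
  \<comment> \<open>The end \<open>u\<close> of the edge is written as \<open>ept u v 0\<close> so
    that the cell and length lemmas for edge points apply; the walk to it has length
    \<open>t\<close>, at most 1.\<close>
  have "walk G p (ept u v 0) (seg_length G p (ept u v 0))"
    using * by (intro walk_edge[of "{u, v}"]) (auto simp del: ept_0 intro: ept_cell)
  moreover have "seg_length G p (ept u v 0) \<le> 1"
    using * seg_length_ept[OF *(1), of t 0] by simp
  ultimately show ?thesis using that edge_verts[OF *(1)] by simp
qed

lemma walk_exists:
  assumes "p \<in> points G" "q \<in> points G"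
  shows "\<exists>l. walk G p q l"
proof -
  obtain u l where u: "u \<in> verts G" "walk G p (vpt u) l" using walk_to_vert[OF assms(1)] by metis
  obtain v m where v: "v \<in> verts G" "walk G q (vpt v) m" using walk_to_vert[OF assms(2)] by metis
  obtain k where "walk G (vpt u) (vpt v) k" using walk_verts[OF u(1) v(1)] by blast
  from walk_trans[OF walk_trans[OF walk_sym[OF v(2)] this] u(2)] show ?thesis ..
qed

lemma gdist_le_walk: "walk G p q l \<Longrightarrow> gdist G p q \<le> l"
  unfolding gdist_walk by (rule cInf_lower) (auto simp: bdd_below_def intro: walk_nonneg)

lemma gdist_ge:
  assumes "p \<in> points G" "q \<in> points G" "\<And>l. walk G p q l \<Longrightarrow> c \<le> l"
  shows "c \<le> gdist G p q"
  unfolding gdist_walk by (rule cInf_greatest) (use assms walk_exists in auto)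

lemma gdist_nonneg: "p \<in> points G \<Longrightarrow> q \<in> points G \<Longrightarrow> 0 \<le> gdist G p q"
  by (rule gdist_ge) (auto intro: walk_nonneg)

lemma gdist_sym: "gdist G p q = gdist G q p"
  unfolding gdist_walk by (rule arg_cong[of _ _ Inf]) (use walk_sym in blast)

lemma gdist_refl [simp]: "p \<in> points G \<Longrightarrow> gdist G p p = 0"
  using gdist_le_walk[OF walk.refl] gdist_nonneg by (metis order_antisym)

lemma gdist_triangle:
  assumes "p \<in> points G" "q \<in> points G" "s \<in> points G"
  shows "gdist G p s \<le> gdist G p q + gdist G q s"
proof -
  have "gdist G p s - gdist G p q \<le> gdist G q s"
  proof (rule gdist_ge[OF assms(2,3)])
    fix m assume m: "walk G q s m"
    have "gdist G p s - m \<le> gdist G p q"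
    proof (rule gdist_ge[OF assms(1,2)])
      fix l assume "walk G p q l"
      from gdist_le_walk[OF walk_trans[OF m this]] show "gdist G p s - m \<le> l" by simp
    qed
    then show "gdist G p s - gdist G p q \<le> m" by simp
  qed
  then show ?thesis by simp
qed

lemma gdist_le_seg: "e \<in> edges G \<Longrightarrow> p \<in> cell e \<Longrightarrow> q \<in> cell e \<Longrightarrow> gdist G p q \<le> seg_length G p q"
  by (intro gdist_le_walk walk_edge)

lemma gdist_ept_le: "{u, v} \<in> edges G \<Longrightarrow> s \<in> {0..1} \<Longrightarrow> t \<in> {0..1} \<Longrightarrow> gdist G (ept u v s) (ept u v t) \<le> \<bar>s - t\<bar>"
  using gdist_le_seg[of "{u, v}" "ept u v s" "ept u v t"] by (simp add: ept_cell seg_length_ept)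

text \<open>The path metric is the largest pseudometric bounded by the segment lengths.  All lower bounds
  on \<open>gdist\<close> below come from this.\<close>

lemma gdist_greatest:
  assumes pq: "p \<in> points G" "q \<in> points G"
    and refl: "\<And>p. p \<in> points G \<Longrightarrow> D p p \<le> 0"
    and tri: "\<And>p q s. p \<in> points G \<Longrightarrow> q \<in> points G \<Longrightarrow> s \<in> points G \<Longrightarrow> D p s \<le> D p q + D q s"
    and seg: "\<And>e p q. e \<in> edges G \<Longrightarrow> p \<in> cell e \<Longrightarrow> q \<in> cell e \<Longrightarrow> D p q \<le> seg_length G p q"
  shows "D p q \<le> gdist G p q"
proof (rule gdist_ge[OF pq])
  fix l assume "walk G p q l"
  then show "D p q \<le> l"
  proof (induction rule: walk.induct)
    case (step q l e s)
    have "D p s \<le> D p q + D q s"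
      using step walk_points cell_subset_points by (intro tri) blast+
    then show ?case using seg[OF step.hyps(2-4)] step.IH by linarith
  qed (simp add: refl)
qed

text \<open>Half the l1 distance of the coordinates is itself a pseudometric on all points, so the
  maximality of the path metric applies to it. It follows that \<open>gdist\<close> separates
  points.\<close>

lemma seg_length_le_gdist: "p \<in> points G \<Longrightarrow> q \<in> points G \<Longrightarrow> seg_length G p q \<le> gdist G p q"
  by (rule gdist_greatest) (auto intro: seg_length_triangle)

lemma gdist_eq_0:
  assumes "p \<in> points G" "q \<in> points G" "gdist G p q = 0"
  shows "p = q"
proof
  fix x
  have "seg_length G p q = 0"
    using seg_length_le_gdist[OF assms(1,2)] seg_length_nonneg[of G p q] assms(3) by simp
  then have "\<forall>x\<in>verts G. p x = q x"
    unfolding seg_length_def by (simp add: sum_nonneg_eq_0_iff)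
  then show "p x = q x" using points_outside assms(1,2) by metis
qed

text \<open>Each point is within 1 of a vertex, and there are finitely many pairs of
  vertices.\<close>

lemma gdist_bounded: "\<exists>K. \<forall>p\<in>points G. \<forall>q\<in>points G. gdist G p q \<le> K"
proof -
  let ?A = "(\<lambda>(u, v). gdist G (vpt u) (vpt v)) ` (verts G \<times> verts G)"
  have fin: "finite ?A" by simp
  have "gdist G p q \<le> 2 + Max ?A" if pq: "p \<in> points G" "q \<in> points G" for p q
  proof -
    obtain u l where u: "u \<in> verts G" "l \<le> 1" "walk G p (vpt u) l" by (rule walk_to_vert[OF pq(1)])
    obtain v m where v: "v \<in> verts G" "m \<le> 1" "walk G q (vpt v) m" by (rule walk_to_vert[OF pq(2)])
    have "gdist G (vpt u) (vpt v) \<le> Max ?A" using u(1) v(1) fin by (intro Max_ge) force+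
    moreover have "gdist G p (vpt u) \<le> 1" "gdist G (vpt v) q \<le> 1"
      using gdist_le_walk[OF u(3)] gdist_le_walk[OF v(3)] u(2) v(2) gdist_sym[of q] by simp_all
    moreover have "gdist G p q \<le> gdist G p (vpt u) + gdist G (vpt u) q"
      "gdist G (vpt u) q \<le> gdist G (vpt u) (vpt v) + gdist G (vpt v) q"
      using pq u v vpt_points by (auto intro: gdist_triangle)
    ultimately show ?thesis by linarith
  qed
  then show ?thesis by blast
qed

lemma points_nonempty: "\<exists>p. p \<in> points G"
  using connected vpt_points unfolding connected_graph_def by blast

end

section \<open>Similarities between metric graphs\<close>

lemma graph_delta_le_similar:
  assumes "metric_graph G" "metric_graph H" and s: "0 < s"
    and into: "\<Phi> ` points G \<subseteq> points H" "\<Psi> ` points H \<subseteq> points G"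
    and inv: "\<And>p. p \<in> points H \<Longrightarrow> \<Phi> (\<Psi> p) = p"
    and dist: "\<And>p q. p \<in> points G \<Longrightarrow> q \<in> points G \<Longrightarrow> gdist H (\<Phi> p) (\<Phi> q) = s * gdist G p q"
  shows "graph_delta H \<le> s * graph_delta G"
proof -
  interpret G: metric_graph G by fact
  interpret H: metric_graph H by fact
  obtain x0 where x0: "x0 \<in> points H" using H.points_nonempty by blast
  obtain K where K: "\<And>p q. p \<in> points G \<Longrightarrow> q \<in> points G \<Longrightarrow> gdist G p q \<le> K"
    using G.gdist_bounded by blast
  show ?thesis
    unfolding graph_delta_def
    by (rule hyp_const_le_similar[where base = x0 and K = K and \<Phi> = \<Phi> and \<Psi> = \<Psi>])
      (fact x0 H.gdist_refl[OF x0] s G.gdist_nonneg K into inv dist)+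
qed

text \<open>The two Lipschitz conditions are local, for pairs in one cell. Maximality of the path
  metric extends them to all pairs, and since the maps are mutually inverse and the constants
  reciprocal, the two bounds combine to an equality of distances.\<close>

lemma graph_delta_similar:
  assumes GH: "metric_graph G" "metric_graph H" and s: "0 < s"
    and into: "\<Phi> ` points G \<subseteq> points H" "\<Psi> ` points H \<subseteq> points G"
    and inv: "\<And>p. p \<in> points G \<Longrightarrow> \<Psi> (\<Phi> p) = p" "\<And>p. p \<in> points H \<Longrightarrow> \<Phi> (\<Psi> p) = p"
    and \<Phi>: "\<And>e p q. e \<in> edges G \<Longrightarrow> p \<in> cell e \<Longrightarrow> q \<in> cell e \<Longrightarrow>
      gdist H (\<Phi> p) (\<Phi> q) \<le> s * seg_length G p q"
    and \<Psi>: "\<And>e p q. e \<in> edges H \<Longrightarrow> p \<in> cell e \<Longrightarrow> q \<in> cell e \<Longrightarrow>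
      s * gdist G (\<Psi> p) (\<Psi> q) \<le> seg_length H p q"
  shows "graph_delta H = s * graph_delta G"
proof -
  interpret G: metric_graph G by fact
  interpret H: metric_graph H by fact
  have *: "gdist H (\<Phi> p) (\<Phi> q) = s * gdist G p q" if pq: "p \<in> points G" "q \<in> points G" for p q
  proof (rule antisym)
    \<comment> \<open>The metric of \<open>H\<close>, pulled back along \<open>\<Phi>\<close> and
      divided by \<open>s\<close>, is a pseudometric on \<open>G\<close> bounded by the segment
      lengths.\<close>
    have "gdist H (\<Phi> p) (\<Phi> q) / s \<le> gdist G p q"
    proof (rule G.gdist_greatest[OF pq])
      show "gdist H (\<Phi> p) (\<Phi> p) / s \<le> 0" if "p \<in> points G" for p
        using that into(1) by (simp add: image_subset_iff)
      show "gdist H (\<Phi> p) (\<Phi> t) / s \<le> gdist H (\<Phi> p) (\<Phi> q) / s + gdist H (\<Phi> q) (\<Phi> t) / s"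
        if "p \<in> points G" "q \<in> points G" "t \<in> points G" for p q t
        unfolding add_divide_distrib[symmetric] using that into(1) s
        by (intro divide_right_mono H.gdist_triangle) auto
      show "gdist H (\<Phi> p) (\<Phi> q) / s \<le> seg_length G p q"
        if "e \<in> edges G" "p \<in> cell e" "q \<in> cell e" for e p q
        using \<Phi>[OF that] s by (simp add: divide_le_eq mult.commute)
    qed
    then show "gdist H (\<Phi> p) (\<Phi> q) \<le> s * gdist G p q" using s by (simp add: divide_le_eq mult.commute)
    \<comment> \<open>The same argument on \<open>H\<close>, for the metric of \<open>G\<close>
      pulled back along \<open>\<Psi>\<close> and multiplied by \<open>s\<close>.\<close>
    have "s * gdist G (\<Psi> (\<Phi> p)) (\<Psi> (\<Phi> q)) \<le> gdist H (\<Phi> p) (\<Phi> q)"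
    proof (rule H.gdist_greatest)
      show "\<Phi> p \<in> points H" "\<Phi> q \<in> points H" using pq into(1) by auto
      show "s * gdist G (\<Psi> p) (\<Psi> p) \<le> 0" if "p \<in> points H" for p
        using that into(2) by (simp add: image_subset_iff)
      show "s * gdist G (\<Psi> p) (\<Psi> t) \<le> s * gdist G (\<Psi> p) (\<Psi> q) + s * gdist G (\<Psi> q) (\<Psi> t)"
        if "p \<in> points H" "q \<in> points H" "t \<in> points H" for p q t
        unfolding distrib_left[symmetric] using that into(2) s
        by (intro mult_left_mono G.gdist_triangle) auto
    qed (rule \<Psi>)
    then show "s * gdist G p q \<le> gdist H (\<Phi> p) (\<Phi> q)" using inv(1) pq by simp
  qed
  have 1: "graph_delta H \<le> s * graph_delta G"
    by (rule graph_delta_le_similar[OF GH s into inv(2) *])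
  have "gdist G (\<Psi> p) (\<Psi> q) = (1 / s) * gdist H p q" if "p \<in> points H" "q \<in> points H" for p q
    using *[of "\<Psi> p" "\<Psi> q"] that into(2) inv(2) s by (simp add: image_subset_iff)
  then have "graph_delta G \<le> (1 / s) * graph_delta H"
    using s by (intro graph_delta_le_similar[OF GH(2,1) _ into(2,1) inv(1)]) auto
  then show ?thesis using 1 s by (simp add: divide_simps mult.commute)
qed

subsection \<open>Relabelling\<close>

definition relabel :: "('a \<Rightarrow> 'b) \<Rightarrow> 'a sgraph \<Rightarrow> 'b sgraph" where
  "relabel f G = \<lparr>verts = f ` verts G, edges = (`) f ` edges G\<rparr>"

context metric_graph
begin

lemma edge_subset: "e \<in> edges G \<Longrightarrow> e \<subseteq> verts G"
  by (erule edgeE) simp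

lemma metric_graph_relabel:
  assumes "inj_on f (verts G)"
  shows "metric_graph (relabel f G)"
proof
  have "\<exists>u v. e = {u, v} \<and> u \<in> f ` verts G \<and> v \<in> f ` verts G \<and> u \<noteq> v"
    if "e \<in> edges (relabel f G)" for e
  proof -
    obtain e' where e': "e' \<in> edges G" "e = f ` e'" using \<open>e \<in> _\<close> by (auto simp: relabel_def)
    obtain u v where "e' = {u, v}" "u \<in> verts G" "v \<in> verts G" "u \<noteq> v"
      by (rule edgeE[OF e'(1)])
    then show ?thesis
      using e'(2) assms by (intro exI[of _ "f u"] exI[of _ "f v"]) (simp add: inj_on_eq_iff)
  qed
  then show "simple_graph (relabel f G)"
    unfolding simple_graph_def by (auto simp: relabel_def)
  show "connected_graph (relabel f G)"
    unfolding connected_graph_def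
  proof (intro conjI ballI)
    show "verts (relabel f G) \<noteq> {}"
      using connected by (simp add: connected_graph_def relabel_def)
    fix u v assume "u \<in> verts (relabel f G)" "v \<in> verts (relabel f G)"
    then obtain a b where ab: "a \<in> verts G" "b \<in> verts G" "u = f a" "v = f b"
      by (auto simp: relabel_def)
    have "(a, b) \<in> {(a, b). {a, b} \<in> edges G}\<^sup>*"
      using ab connected unfolding connected_graph_def by blast
    then have "(f a, f b) \<in> {(a, b). {a, b} \<in> edges (relabel f G)}\<^sup>*"
    proof (induction rule: rtrancl_induct)
      case (step y z)
      then have "f ` {y, z} \<in> edges (relabel f G)" by (simp add: relabel_def del: image_insert)
      then show ?case using step.IH by (intro rtrancl_into_rtrancl[OF step.IH]) simp
    qed simp
    then show "(u, v) \<in> {(a, b). {a, b} \<in> edges (relabel f G)}\<^sup>*" using ab by simp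
  qed
qed

text \<open>Coordinates are transported along \<open>f\<close>. Both transports respect cells and
  segment lengths, so the similarity criterion applies with ratio 1.\<close>

lemma graph_delta_relabel:
  assumes inj: "inj_on f (verts G)"
  shows "graph_delta (relabel f G) = graph_delta G"
proof -
  let ?H = "relabel f G"
  interpret H: metric_graph ?H by (rule metric_graph_relabel[OF inj])
  have VH: "verts ?H = f ` verts G" by (simp add: relabel_def)
  \<comment> \<open>Points vanish off the vertex set; the value 0 there makes the two transports
    inverse to each other as functions on the whole type.\<close>
  define \<Phi> :: "('a \<Rightarrow> real) \<Rightarrow> 'b \<Rightarrow> real"
    where "\<Phi> p = (\<lambda>y. if y \<in> f ` verts G then p (inv_into (verts G) f y) else 0)" for p
  define \<Psi> :: "('b \<Rightarrow> real) \<Rightarrow> 'a \<Rightarrow> real"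
    where "\<Psi> P = (\<lambda>x. if x \<in> verts G then P (f x) else 0)" for P
  have \<Phi>f: "\<Phi> p (f x) = p x" if "x \<in> verts G" for p x
    using that inj by (simp add: \<Phi>_def)
  have sum_img: "(\<Sum>y\<in>f ` S. h y) = (\<Sum>x\<in>S. h (f x))" if "S \<subseteq> verts G" for S and h :: "'b \<Rightarrow> real"
    by (simp add: sum.reindex[OF inj_on_subset[OF inj that]])
  have \<Phi>cell: "\<Phi> p \<in> cell (f ` S)" if S: "S \<subseteq> verts G" and p: "p \<in> cell S" for p S
  proof -
    have "(\<Sum>y\<in>f ` S. \<Phi> p y) = (\<Sum>x\<in>S. p x)"
      unfolding sum_img[OF S] by (rule sum.cong) (use S \<Phi>f in auto)
    moreover have "\<Phi> p y = 0" if "y \<notin> f ` S" for y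
    proof (cases "y \<in> f ` verts G")
      case True
      then obtain x where "x \<in> verts G" "y = f x" by blast
      then show ?thesis using \<Phi>f that p by (auto simp: cell_def)
    qed (simp add: \<Phi>_def)
    ultimately show ?thesis using p by (auto simp: cell_def \<Phi>_def)
  qed
  have \<Psi>cell: "\<Psi> P \<in> cell S" if S: "S \<subseteq> verts G" and P: "P \<in> cell (f ` S)" for P S
  proof -
    have "(\<Sum>x\<in>S. \<Psi> P x) = (\<Sum>y\<in>f ` S. P y)"
      unfolding sum_img[OF S] by (rule sum.cong) (use S in \<open>auto simp: \<Psi>_def\<close>)
    moreover have "\<Psi> P x = 0" if "x \<notin> S" for x
    proof (cases "x \<in> verts G")
      case True
      then have "f x \<notin> f ` S" using that S inj by (simp add: inj_on_image_mem_iff)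
      then show ?thesis using P by (simp add: \<Psi>_def cell_def)
    qed (simp add: \<Psi>_def)
    ultimately show ?thesis using P by (auto simp: cell_def \<Psi>_def)
  qed
  have seg\<Phi>: "seg_length ?H (\<Phi> p) (\<Phi> q) = seg_length G p q" for p q
    unfolding seg_length_def VH sum_img[OF order_refl] by (simp add: \<Phi>f)
  have seg\<Psi>: "seg_length G (\<Psi> P) (\<Psi> Q) = seg_length ?H P Q" for P Q
    unfolding seg_length_def VH sum_img[OF order_refl] by (simp add: \<Psi>_def)
  have edgesH: "\<exists>e'\<in>edges G. e = f ` e'" if "e \<in> edges ?H" for e
    using that by (auto simp: relabel_def)
  have "graph_delta ?H = 1 * graph_delta G"
  proof (rule graph_delta_similar[where \<Phi> = \<Phi> and \<Psi> = \<Psi>])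
    show "metric_graph G" "metric_graph ?H" by unfold_locales
    show "\<Phi> ` points G \<subseteq> points ?H"
    proof (rule image_subsetI)
      fix p assume "p \<in> points G"
      then consider v where "v \<in> verts G" "p \<in> cell {v}" | e where "e \<in> edges G" "p \<in> cell e"
        unfolding points_def by blast
      then show "\<Phi> p \<in> points ?H"
      proof cases
        case 1
        then show ?thesis using \<Phi>cell[of "{v}" p] by (auto simp: points_def relabel_def)
      next
        case 2
        then have "\<Phi> p \<in> cell (f ` e)" by (intro \<Phi>cell edge_subset)
        then show ?thesis using 2 by (auto simp: points_def relabel_def)
      qed
    qed
    show "\<Psi> ` points ?H \<subseteq> points G"
    proof (rule image_subsetI)
      fix P assume "P \<in> points ?H"
      then consider v where "v \<in> verts G" "P \<in> cell (f ` {v})" | e where "e \<in> edges G" "P \<in> cell (f ` e)"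
        unfolding points_def relabel_def by auto
      then show "\<Psi> P \<in> points G"
      proof cases
        case 1
        then show ?thesis using \<Psi>cell[of "{v}" P] by (auto simp: points_def)
      next
        case 2
        then have "\<Psi> P \<in> cell e" by (intro \<Psi>cell edge_subset)
        then show ?thesis using 2 by (auto simp: points_def)
      qed
    qed
    show "\<Psi> (\<Phi> p) = p" if "p \<in> points G" for p
      using points_outside[OF that] by (auto simp: \<Psi>_def \<Phi>f fun_eq_iff)
    show "\<Phi> (\<Psi> P) = P" if "P \<in> points ?H" for P
    proof
      fix y
      show "\<Phi> (\<Psi> P) y = P y"
      proof (cases "y \<in> f ` verts G")
        case True
        then obtain x where "x \<in> verts G" "y = f x" by blast
        then show ?thesis by (simp add: \<Phi>f \<Psi>_def)
      next
        case False
        then show ?thesis using H.points_outside[OF that, of y] by (simp add: \<Phi>_def VH)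
      qed
    qed
    show "gdist ?H (\<Phi> p) (\<Phi> q) \<le> 1 * seg_length G p q"
      if "e \<in> edges G" "p \<in> cell e" "q \<in> cell e" for e p q
    proof -
      have "f ` e \<in> edges ?H" using that(1) by (simp add: relabel_def)
      then show ?thesis
        using H.gdist_le_seg[of "f ` e" "\<Phi> p" "\<Phi> q"] \<Phi>cell[OF edge_subset] that by (simp add: seg\<Phi>)
    qed
    show "1 * gdist G (\<Psi> P) (\<Psi> Q) \<le> seg_length ?H P Q"
      if e: "e \<in> edges ?H" "P \<in> cell e" "Q \<in> cell e" for e P Q
    proof -
      obtain e' where e': "e' \<in> edges G" "e = f ` e'" using edgesH[OF e(1)] by blast
      then show ?thesis
        using gdist_le_seg[OF e'(1), of "\<Psi> P" "\<Psi> Q"] \<Psi>cell[OF edge_subset[OF e'(1)]] e by (simp add: seg\<Psi>)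
    qed
  qed simp
  then show ?thesis by simp
qed

end

subsection \<open>Subdivision\<close>

text \<open>The subdivision is realised inside the metric graph of \<open>G\<close>, with points of it as vertices.\<close>

definition subdivide :: "nat \<Rightarrow> 'a sgraph \<Rightarrow> ('a \<Rightarrow> real) sgraph" where
  "subdivide r G =
     \<lparr>verts = {p \<in> points G. \<forall>x. real r * p x \<in> \<nat>},
      edges = {{ept u v (real j / real r), ept u v (real (Suc j) / real r)} | u v j.
                {u, v} \<in> edges G \<and> j < r}\<rparr>"

lemma ept_apply: "u \<noteq> v \<Longrightarrow> ept u v t v = t" "ept u v t u = 1 - t"
  "x \<notin> {u, v} \<Longrightarrow> ept u v t x = 0"
  unfolding ept_def by auto

lemma ept_eq_iff: "u \<noteq> v \<Longrightarrow> ept u v s = ept u v t \<longleftrightarrow> s = t"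
  using ept_apply(1) by metis

text \<open>The coordinates of both points sum to 1, so a change at \<open>x\<close> is compensated
  at the other vertices, and half the l1 distance still dominates it.\<close>

lemma (in metric_graph) seg_length_ge:
  assumes pq: "p \<in> points G" "q \<in> points G"
  shows "\<bar>p x - q x\<bar> \<le> seg_length G p q"
proof (cases "x \<in> verts G")
  case True
  let ?d = "\<lambda>y. p y - q y"
  have "(\<Sum>y\<in>verts G. ?d y) = 0" using points_sum pq by (simp add: sum_subtractf)
  then have "\<bar>?d x\<bar> = \<bar>\<Sum>y\<in>verts G - {x}. ?d y\<bar>"
    using sum.remove[OF finite_verts True, of ?d] by linarith
  also have "\<dots> \<le> (\<Sum>y\<in>verts G - {x}. \<bar>?d y\<bar>)" by (rule sum_abs)
  finally show ?thesis
    using sum.remove[OF finite_verts True, of "\<lambda>y. \<bar>?d y\<bar>"] by (simp add: seg_length_def)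
next
  case False
  then show ?thesis using pq[THEN points_outside] by (simp add: seg_length_nonneg)
qed

section \<open>Grid points and the subdivided graph\<close>

locale subdivision = metric_graph G for G :: "'a sgraph" +
  fixes r :: nat
  assumes r_pos: "0 < r" and edges_nonempty: "edges G \<noteq> {}"
begin

abbreviation "H \<equiv> subdivide r G"

definition gridpt :: "'a \<Rightarrow> 'a \<Rightarrow> nat \<Rightarrow> 'a \<Rightarrow> real" where
  "gridpt u v j = ept u v (real j / real r)"

lemma verts_H: "verts H = {p \<in> points G. \<forall>x. real r * p x \<in> \<nat>}"
  by (simp add: subdivide_def)

lemma edges_H: "edges H = {{gridpt u v j, gridpt u v (Suc j)} | u v j. {u, v} \<in> edges G \<and> j < r}"
  by (simp add: subdivide_def gridpt_def)

lemma edges_HI: "{u, v} \<in> edges G \<Longrightarrow> j < r \<Longrightarrow> {gridpt u v j, gridpt u v (Suc j)} \<in> edges H"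
  unfolding edges_H by blast

lemma edges_HE:
  assumes "e \<in> edges H"
  obtains u v j where "{u, v} \<in> edges G" "j < r" "e = {gridpt u v j, gridpt u v (Suc j)}"
  using assms unfolding edges_H by blast

text \<open>Some edge exists, so there is a vertex other than \<open>v\<close>, and a path to it
  starts with an edge at \<open>v\<close>. Hence every point lies on an edge, and original vertices
  can be treated as grid points with index 0.\<close>

lemma neighbour_exists:
  assumes "v \<in> verts G"
  shows "\<exists>u. {v, u} \<in> edges G"
proof -
  obtain e where "e \<in> edges G" using edges_nonempty by blast
  then obtain a b where ab: "a \<in> verts G" "b \<in> verts G" "a \<noteq> b" by (rule edgeE)
  obtain w where w: "w \<in> verts G" "v \<noteq> w" using ab by (cases "v = a") auto
  have "(v, w) \<in> {(a, b). {a, b} \<in> edges G}\<^sup>*"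
    using assms w connected unfolding connected_graph_def by blast
  then show ?thesis using w(2) by (cases rule: converse_rtranclE) auto
qed

lemma gridpt_0 [simp]: "gridpt u v 0 = vpt u"
  by (simp add: gridpt_def)

lemma gridpt_r: "{u, v} \<in> edges G \<Longrightarrow> gridpt u v r = vpt v"
  using r_pos edge_verts(3)[of u v] by (simp add: gridpt_def)

lemma gridpt_sym: "{u, v} \<in> edges G \<Longrightarrow> j \<le> r \<Longrightarrow> gridpt v u j = gridpt u v (r - j)"
  using r_pos edge_verts(3)[of u v]
  by (simp add: gridpt_def ept_sym[of u v] of_nat_diff diff_divide_distrib)

lemma gridpt_eq_iff: "{u, v} \<in> edges G \<Longrightarrow> gridpt u v i = gridpt u v j \<longleftrightarrow> i = j"
  using r_pos edge_verts(3)[of u v] by (simp add: gridpt_def ept_eq_iff)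

lemma gridpt_verts:
  assumes "{u, v} \<in> edges G" "j \<le> r"
  shows "gridpt u v j \<in> verts H"
proof -
  have "real r * gridpt u v j x \<in> \<nat>" for x
  proof -
    have "real r * gridpt u v j x \<in> {real (r - j), real j, 0}"
      using r_pos assms(2) by (auto simp: gridpt_def ept_def of_nat_diff right_diff_distrib)
    then show ?thesis by (metis Nats_0 empty_iff insertE of_nat_in_Nats)
  qed
  then show ?thesis
    using assms r_pos ept_points[of u v "real j / real r"] by (simp add: verts_H gridpt_def)
qed

text \<open>The coordinates at \<open>u\<close> and \<open>v\<close> sum to 1, so the point is
  determined by \<open>p v\<close>; integrality of \<open>real r * p v\<close> yields the
  index.\<close>

lemma verts_H_supported:
  assumes p: "p \<in> verts H" and e: "{u, v} \<in> edges G" and supp: "\<And>x. x \<notin> {u, v} \<Longrightarrow> p x = 0"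
  shows "\<exists>j\<le>r. p = gridpt u v j"
proof -
  note uv = edge_verts[OF e]
  have pp: "p \<in> points G" using p by (simp add: verts_H)
  have "(\<Sum>x\<in>verts G. p x) = (\<Sum>x\<in>{u, v}. p x)"
    by (rule sum.mono_neutral_right) (use uv supp in auto)
  then have s: "p u + p v = 1" using points_sum[OF pp] uv(3) by simp
  have "real r * p v \<in> \<nat>" using p by (simp add: verts_H)
  then obtain j where j: "real r * p v = real j" by (auto elim: Nats_cases)
  have pv: "p v = real j / real r" using j r_pos by (simp add: field_simps)
  have "p v \<le> 1" using s points_nonneg[OF pp, of u] by simp
  then have "j \<le> r" using pv r_pos by (simp add: divide_le_eq)
  moreover have "p = gridpt u v j"
    using s supp pv by (auto simp: gridpt_def ept_def fun_eq_iff)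
  ultimately show ?thesis by blast
qed

lemma verts_HE:
  assumes "p \<in> verts H"
  obtains u v j where "{u, v} \<in> edges G" "j \<le> r" "p = gridpt u v j"
proof -
  have pp: "p \<in> points G" using assms by (simp add: verts_H)
  then show ?thesis
  proof (rule pointsE)
    fix v assume v: "v \<in> verts G" "p = vpt v"
    obtain u where "{v, u} \<in> edges G" using neighbour_exists[OF v(1)] by blast
    then show ?thesis using that[of v u 0] v(2) by simp
  next
    fix u v t assume *: "{u, v} \<in> edges G" "p = ept u v t"
    have "\<exists>j\<le>r. p = gridpt u v j"
      by (rule verts_H_supported[OF assms *(1)]) (simp add: *(2) ept_apply)
    then show ?thesis using that *(1) by blast
  qed
qed

lemma finite_verts_H: "finite (verts H)"
proof (rule finite_subset)
  show "verts H \<subseteq> (\<lambda>(u, v, j). gridpt u v j) ` (verts G \<times> verts G \<times> {..r})"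
  proof
    fix p assume "p \<in> verts H"
    then obtain u v j where *: "{u, v} \<in> edges G" "j \<le> r" "p = gridpt u v j" by (rule verts_HE)
    then show "p \<in> (\<lambda>(u, v, j). gridpt u v j) ` (verts G \<times> verts G \<times> {..r})"
      using edge_verts[OF *(1)] by (intro image_eqI[of _ _ "(u, v, j)"]) auto
  qed
qed simp

lemma gridpt_reachable:
  assumes "{u, v} \<in> edges G" "j \<le> r"
  shows "(vpt u, gridpt u v j) \<in> {(a, b). {a, b} \<in> edges H}\<^sup>*"
  using assms(2)
proof (induction j)
  case (Suc j)
  then have "{gridpt u v j, gridpt u v (Suc j)} \<in> edges H" using assms(1) by (intro edges_HI) auto
  then show ?case using Suc by (intro rtrancl_into_rtrancl[OF Suc.IH]) auto
qed simp

lemma metric_graph_H: "metric_graph H"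
proof
  have "\<exists>a b. e = {a, b} \<and> a \<in> verts H \<and> b \<in> verts H \<and> a \<noteq> b" if e: "e \<in> edges H" for e
  proof -
    obtain u v j where *: "{u, v} \<in> edges G" "j < r" "e = {gridpt u v j, gridpt u v (Suc j)}"
      by (rule edges_HE[OF e])
    then show ?thesis
      using gridpt_verts[OF *(1)] gridpt_eq_iff[OF *(1)]
      by (intro exI[of _ "gridpt u v j"] exI[of _ "gridpt u v (Suc j)"]) simp
  qed
  then show "simple_graph H" unfolding simple_graph_def using finite_verts_H by blast
  let ?R = "{(a, b). {a, b} \<in> edges H}"
  have symR: "(b, a) \<in> ?R\<^sup>*" if "(a, b) \<in> ?R\<^sup>*" for a b
  proof -
    have "sym ?R" by (auto simp: sym_def insert_commute)
    then show ?thesis using that by (metis sym_rtrancl symD)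
  qed
  have vv: "(vpt u, vpt v) \<in> ?R\<^sup>*" if "u \<in> verts G" "v \<in> verts G" for u v
  proof -
    have "(u, v) \<in> {(a, b). {a, b} \<in> edges G}\<^sup>*"
      using that connected unfolding connected_graph_def by blast
    then show ?thesis
    proof (induction rule: rtrancl_induct)
      case (step y z)
      then have "{y, z} \<in> edges G" by simp
      from gridpt_reachable[OF this order_refl] gridpt_r[OF this]
      have "(vpt y, vpt z) \<in> ?R\<^sup>*" by simp
      then show ?case using step.IH by (rule rtrancl_trans[rotated])
    qed simp
  qed
  show "connected_graph H"
    unfolding connected_graph_def
  proof (intro conjI ballI)
    obtain e where "e \<in> edges G" using edges_nonempty by blast
    then obtain a b where "e = {a, b}" by (rule edgeE)
    then show "verts H \<noteq> {}" using gridpt_verts[of a b 0] \<open>e \<in> edges G\<close> by blast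
    fix p q assume "p \<in> verts H" "q \<in> verts H"
    obtain u v i where p: "{u, v} \<in> edges G" "i \<le> r" "p = gridpt u v i" by (rule verts_HE[OF \<open>p \<in> _\<close>])
    obtain u' v' j where q: "{u', v'} \<in> edges G" "j \<le> r" "q = gridpt u' v' j" by (rule verts_HE[OF \<open>q \<in> _\<close>])
    have "(p, vpt u) \<in> ?R\<^sup>*" using symR[OF gridpt_reachable[OF p(1,2)]] p(3) by simp
    moreover have "(vpt u, vpt u') \<in> ?R\<^sup>*" using vv edge_verts(1)[OF p(1)] edge_verts(1)[OF q(1)] by blast
    moreover have "(vpt u', q) \<in> ?R\<^sup>*" using gridpt_reachable[OF q(1,2)] q(3) by simp
    ultimately show "(p, q) \<in> ?R\<^sup>*" by (meson rtrancl_trans)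
  qed
qed

sublocale H: metric_graph H by (rule metric_graph_H)

text \<open>\<open>fine\<close> maps the metric graph of \<open>G\<close> to that of \<open>H\<close>: the barycentric coordinates are hat functions
  around the grid points.  Its inverse \<open>coarse\<close> takes barycentres.\<close>

definition fine :: "('a \<Rightarrow> real) \<Rightarrow> ('a \<Rightarrow> real) \<Rightarrow> real" where
  "fine p = (\<lambda>q. if q \<in> verts H then max 0 (1 - real r * seg_length G p q) else 0)"

definition coarse :: "(('a \<Rightarrow> real) \<Rightarrow> real) \<Rightarrow> 'a \<Rightarrow> real" where
  "coarse P = (\<lambda>x. \<Sum>q\<in>verts H. P q * q x)"

text \<open>On a single piece of an edge only the hat functions of its two ends can be nonzero. Any
  other grid point is at segment distance at least \<open>1 / r\<close>: along the edge because
  indices are integers, off the edge because it has a coordinate of at least \<open>1 / r\<close> at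
  a vertex where \<open>ept u v t\<close> vanishes.\<close>

lemma fine_ept:
  assumes e: "{u, v} \<in> edges G" and j: "j < r" "real j \<le> real r * t" "real r * t \<le> real (Suc j)"
  shows "fine (ept u v t) = ept (gridpt u v j) (gridpt u v (Suc j)) (real r * t - real j)"
proof
  fix p
  have uv: "u \<noteq> v" by (rule edge_verts(3)[OF e])
  have "0 \<le> real r * t" using j(2) by (rule order_trans[rotated]) simp
  then have t0: "0 \<le> t" using r_pos by (simp add: zero_le_mult_iff)
  have "real r * t \<le> real r * 1" using j(1,3) by linarith
  then have t1: "t \<le> 1" using r_pos by (simp add: mult_le_cancel_left)
  have pt: "ept u v t \<in> points G" by (rule ept_points[OF e t0 t1])
  have grid: "gridpt u v j \<in> verts H" "gridpt u v (Suc j) \<in> verts H"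
    using gridpt_verts[OF e] j(1) by simp_all
  consider "p \<notin> verts H" | k where "p \<in> verts H" "p = gridpt u v k"
    | x where "p \<in> verts H" "x \<notin> {u, v}" "p x \<noteq> 0"
    using verts_H_supported[OF _ e] by blast
  then show "fine (ept u v t) p = ept (gridpt u v j) (gridpt u v (Suc j)) (real r * t - real j) p"
  proof cases
    case 1
    then have "p \<notin> {gridpt u v j, gridpt u v (Suc j)}" using grid by auto
    then show ?thesis using 1 by (simp add: fine_def ept_apply(3))
  next
    case 2
    have "real r * \<bar>t - real k / real r\<bar> = \<bar>real r * (t - real k / real r)\<bar>" by (simp add: abs_mult)
    also have "\<dots> = \<bar>real r * t - real k\<bar>" using r_pos by (simp add: right_diff_distrib)
    finally have "fine (ept u v t) p = max 0 (1 - \<bar>real r * t - real k\<bar>)"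
      using 2 by (simp add: fine_def gridpt_def seg_length_ept[OF e])
    moreover consider "k = j" | "k = Suc j" | "k < j" | "Suc j < k" by linarith
    then have "max 0 (1 - \<bar>real r * t - real k\<bar>) =
        (if k = j then 1 - (real r * t - real j) else if k = Suc j then real r * t - real j else 0)"
      by cases (use j in auto)
    ultimately show ?thesis
      unfolding 2(2) by (simp add: ept_def[of "gridpt u v j"] gridpt_eq_iff[OF e])
  next
    case 3
    have pp: "p \<in> points G" using 3(1) by (simp add: verts_H)
    have "real r * p x \<in> \<nat>" using 3(1) by (simp add: verts_H)
    then obtain m where m: "real r * p x = real m" by (auto elim: Nats_cases)
    \<comment> \<open>A nonzero coordinate of a grid point is a positive multiple of
      \<open>1 / r\<close>, which is enough to make the hat function vanish.\<close>
    have "m \<noteq> 0"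
    proof
      assume "m = 0"
      then show False using m 3(3) r_pos by simp
    qed
    then have "1 \<le> real r * p x" using m by simp
    also have "real r * p x \<le> real r * seg_length G (ept u v t) p"
      using seg_length_ge[OF pt pp, of x] 3(2) by (intro mult_left_mono) (auto simp: ept_apply(3))
    finally have "fine (ept u v t) p = 0" by (simp add: fine_def)
    moreover have "p \<notin> {gridpt u v j, gridpt u v (Suc j)}"
      using 3(2,3) by (auto simp: gridpt_def ept_apply(3))
    ultimately show ?thesis by (simp add: ept_apply(3))
  qed
qed

lemma coarse_ept:
  assumes e: "{u, v} \<in> edges G" and j: "j < r"
  shows "coarse (ept (gridpt u v j) (gridpt u v (Suc j)) s) = ept u v ((real j + s) / real r)"
proof
  fix x
  let ?a = "gridpt u v j" and ?b = "gridpt u v (Suc j)"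
  have ab: "?a \<noteq> ?b" using gridpt_eq_iff[OF e] by simp
  have "(\<Sum>q\<in>verts H. ept ?a ?b s q * q x) = (\<Sum>q\<in>{?a, ?b}. ept ?a ?b s q * q x)"
    by (rule sum.mono_neutral_right) (use gridpt_verts[OF e] j finite_verts_H in \<open>auto simp: ept_apply(3)\<close>)
  also have "\<dots> = (1 - s) * ?a x + s * ?b x"
    using ab by (simp add: ept_apply(1,2))
  also have "\<dots> = ept u v ((real j + s) / real r) x"
    using r_pos by (simp add: gridpt_def ept_def field_simps)
  finally show "coarse (ept ?a ?b s) x = ept u v ((real j + s) / real r) x" by (simp add: coarse_def)
qed

lemma points_G_E:
  assumes "p \<in> points G"
  obtains u v j t where "{u, v} \<in> edges G" "j < r" "real j \<le> real r * t"
    "real r * t \<le> real (Suc j)" "p = ept u v t"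
proof -
  obtain u v t where *: "{u, v} \<in> edges G" "0 \<le> t" "t \<le> 1" "p = ept u v t"
    using assms
  proof (rule pointsE)
    fix v assume v: "v \<in> verts G" "p = vpt v"
    obtain u where "{v, u} \<in> edges G" using neighbour_exists[OF v(1)] by blast
    then show ?thesis using that[of v u 0] v(2) by simp
  qed (rule that)
  show ?thesis
  proof (cases "t = 1")
    \<comment> \<open>At the far end the floor of \<open>real r * t\<close> would be
      \<open>r\<close>, which is no index of a piece; the last piece \<open>r - 1\<close> contains
      the point.\<close>
    case True
    then show ?thesis using that[of u v "r - 1" t] * r_pos by (simp add: of_nat_diff)
  next
    case False
    define j where "j = nat \<lfloor>real r * t\<rfloor>"
    have "0 \<le> real r * t" using *(2) by simp
    then have "real j = of_int \<lfloor>real r * t\<rfloor>" unfolding j_def by (simp only: of_nat_nat zero_le_floor)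
    then have j: "real j \<le> real r * t" "real r * t \<le> real (Suc j)" by linarith+
    have "real r * t < real r" using False *(3) r_pos by simp
    then have "j < r" using j(1) by linarith
    then show ?thesis using that[OF *(1) _ j *(4)] by blast
  qed
qed

lemma points_H_E:
  assumes "P \<in> points H"
  obtains u v j s where "{u, v} \<in> edges G" "j < r" "0 \<le> s" "s \<le> 1"
    "P = ept (gridpt u v j) (gridpt u v (Suc j)) s"
  using assms
proof (rule H.pointsE)
  fix p assume p: "p \<in> verts H" "P = vpt p"
  obtain u v j where *: "{u, v} \<in> edges G" "j \<le> r" "p = gridpt u v j" by (rule verts_HE[OF p(1)])
  show ?thesis
  proof (cases "j < r")
    case True
    then show ?thesis using that[OF *(1) True, of 0] * p by simp
  next
    case False
    \<comment> \<open>The grid point with index \<open>r\<close> starts no piece; it is the end, at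
      parameter 1, of the last one.\<close>
    then have j: "j = Suc (r - 1)" using *(2) r_pos by simp
    then show ?thesis
      using that[OF *(1), of "r - 1" 1] * p r_pos gridpt_eq_iff[OF *(1), of "r - 1" "Suc (r - 1)"] by simp
  qed
next
  fix a b s assume s: "{a, b} \<in> edges H" "0 \<le> s" "s \<le> 1" "P = ept a b s"
  obtain u v j where *: "{u, v} \<in> edges G" "j < r" "{a, b} = {gridpt u v j, gridpt u v (Suc j)}"
    by (rule edges_HE[OF s(1)])
  have ne: "a \<noteq> b" by (rule H.edge_verts(3)[OF s(1)])
  consider "a = gridpt u v j" "b = gridpt u v (Suc j)" | "b = gridpt u v j" "a = gridpt u v (Suc j)"
    using *(3) by (auto simp: doubleton_eq_iff)
  then show ?thesis
  proof cases
    case 1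
    then show ?thesis using that[OF *(1,2) s(2,3)] s(4) by simp
  next
    case 2
    then show ?thesis using that[OF *(1,2), of "1 - s"] s ne ept_sym[of b a s] by simp
  qed
qed

lemma fine_points:
  assumes "p \<in> points G"
  shows "fine p \<in> points H" "coarse (fine p) = p"
proof -
  obtain u v j t where *: "{u, v} \<in> edges G" "j < r" "real j \<le> real r * t"
    "real r * t \<le> real (Suc j)" "p = ept u v t" by (rule points_G_E[OF assms])
  have "fine p = ept (gridpt u v j) (gridpt u v (Suc j)) (real r * t - real j)"
    unfolding *(5) by (rule fine_ept[OF *(1-4)])
  then show "fine p \<in> points H" "coarse (fine p) = p"
    using * r_pos coarse_ept[OF *(1,2)] H.ept_points[OF edges_HI[OF *(1,2)]] by auto
qed

lemma coarse_points:
  assumes "P \<in> points H"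
  shows "coarse P \<in> points G" "fine (coarse P) = P"
proof -
  obtain u v j s where *: "{u, v} \<in> edges G" "j < r" "0 \<le> s" "s \<le> 1"
    "P = ept (gridpt u v j) (gridpt u v (Suc j)) s" by (rule points_H_E[OF assms])
  have c: "coarse P = ept u v ((real j + s) / real r)"
    unfolding *(5) by (rule coarse_ept[OF *(1,2)])
  have "real j + 1 \<le> real r" using *(2) by linarith
  then have "(real j + s) / real r \<le> 1" using *(4) r_pos by (simp add: divide_le_eq)
  then show "coarse P \<in> points G" unfolding c using *(3) by (intro ept_points[OF *(1)]) auto
  have "real r * ((real j + s) / real r) = real j + s" using r_pos by simp
  then show "fine (coarse P) = P"
    unfolding c using fine_ept[OF *(1,2), of "(real j + s) / real r"] *(3-5) by simp
qed

text \<open>Two points of one edge of \<open>G\<close> may lie in different edges of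
  \<open>H\<close>. The induction on the number \<open>k\<close> of pieces that reach up to
  \<open>t\<close> cuts off the last piece, inside which the image is a segment of one cell.\<close>

lemma fine_lipschitz_le:
  assumes e: "{u, v} \<in> edges G" and k: "k \<le> r"
  shows "0 \<le> s \<Longrightarrow> s \<le> t \<Longrightarrow> real r * t \<le> real k \<Longrightarrow>
    gdist H (fine (ept u v s)) (fine (ept u v t)) \<le> real r * (t - s)"
  using k
proof (induction k arbitrary: s t)
  case 0
  then have "t \<le> 0" using r_pos by (simp add: mult_le_0_iff)
  then have "s = 0" "t = 0" using 0 by simp_all
  then show ?case using H.gdist_refl[OF fine_points(1)[OF ept_points[OF e, of 0]]] by simp
next
  case (Suc k)
  have kr: "k < r" using Suc.prems(4) by simp
  have near: "gdist H (fine (ept u v s)) (fine (ept u v t)) \<le> real r * (t - s)"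
    if "real k \<le> real r * s" "s \<le> t" "real r * t \<le> real (Suc k)" for s t
  proof -
    have "real r * s \<le> real r * t" using that(2) by (simp add: mult_left_mono)
    then have st: "real k \<le> real r * t" "real r * s \<le> real (Suc k)" using that by linarith+
    have "gdist H (fine (ept u v s)) (fine (ept u v t)) \<le> \<bar>(real r * s - real k) - (real r * t - real k)\<bar>"
      unfolding fine_ept[OF e kr that(1) st(2)] fine_ept[OF e kr st(1) that(3)]
      by (rule H.gdist_ept_le[OF edges_HI[OF e kr]]) (use that st in auto)
    also have "\<dots> = real r * (t - s)"
      using \<open>real r * s \<le> real r * t\<close> by (simp add: right_diff_distrib)
    finally show ?thesis .
  qed
  consider "real r * t \<le> real k" | "real k \<le> real r * s" | "real r * s < real k" "real k < real r * t"
    by linarith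
  then show ?case
  proof cases
    case 1
    then show ?thesis using Suc by simp
  next
    case 2
    then show ?thesis using near Suc.prems by blast
  next
    case 3
    \<comment> \<open>The grid position that separates the last piece from the earlier ones.\<close>
    define w where "w = real k / real r"
    have w: "real r * w = real k" using r_pos by (simp add: w_def)
    have "s < w" "w < t" using 3 r_pos unfolding w_def by (simp_all add: less_divide_eq divide_less_eq mult.commute)
    have "real r * t \<le> real r * 1" using Suc.prems(3,4) by linarith
    then have t1: "t \<le> 1" using r_pos by (simp add: mult_le_cancel_left)
    have pts: "fine (ept u v z) \<in> points H" if "0 \<le> z" "z \<le> 1" for z
      by (intro fine_points(1) ept_points[OF e] that)
    have "gdist H (fine (ept u v s)) (fine (ept u v w)) \<le> real r * (w - s)"
      by (rule Suc.IH) (use Suc.prems w \<open>s < w\<close> in auto)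
    moreover have "gdist H (fine (ept u v w)) (fine (ept u v t)) \<le> real r * (t - w)"
      by (rule near) (use Suc.prems w \<open>w < t\<close> in auto)
    moreover have "gdist H (fine (ept u v s)) (fine (ept u v t)) \<le>
        gdist H (fine (ept u v s)) (fine (ept u v w)) + gdist H (fine (ept u v w)) (fine (ept u v t))"
      by (intro H.gdist_triangle pts) (use Suc.prems \<open>s < w\<close> \<open>w < t\<close> t1 in auto)
    ultimately show ?thesis by (simp add: right_diff_distrib)
  qed
qed

lemma fine_lipschitz:
  assumes e: "e \<in> edges G" and pq: "p \<in> cell e" "q \<in> cell e"
  shows "gdist H (fine p) (fine q) \<le> real r * seg_length G p q"
proof -
  obtain u v where uv: "e = {u, v}" "u \<noteq> v" by (rule edgeE[OF e])
  then have e': "{u, v} \<in> edges G" using e by simp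
  obtain s t where st: "p = ept u v s" "0 \<le> s" "s \<le> 1" "q = ept u v t" "0 \<le> t" "t \<le> 1"
    using pq unfolding uv(1) cell_edge[OF uv(2)] by auto
  have "real r * s \<le> real r" "real r * t \<le> real r" using st mult_left_mono[of _ 1 "real r"] by auto
  then show ?thesis
    using fine_lipschitz_le[OF e' order_refl, of s t] fine_lipschitz_le[OF e' order_refl, of t s] st
    by (cases "s \<le> t") (auto simp: seg_length_ept[OF e'] H.gdist_sym)
qed

text \<open>No induction occurs in this direction: an edge of \<open>H\<close> lies inside a single
  edge of \<open>G\<close>, where \<open>coarse\<close> is affine with slope
  \<open>1 / r\<close>.\<close>

lemma coarse_lipschitz:
  assumes e: "e \<in> edges H" and PQ: "P \<in> cell e" "Q \<in> cell e"
  shows "real r * gdist G (coarse P) (coarse Q) \<le> seg_length H P Q"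
proof -
  obtain u v j where *: "{u, v} \<in> edges G" "j < r" "e = {gridpt u v j, gridpt u v (Suc j)}"
    by (rule edges_HE[OF e])
  have "gridpt u v j \<noteq> gridpt u v (Suc j)" using gridpt_eq_iff[OF *(1)] by simp
  then obtain s t where st: "P = ept (gridpt u v j) (gridpt u v (Suc j)) s" "0 \<le> s" "s \<le> 1"
      "Q = ept (gridpt u v j) (gridpt u v (Suc j)) t" "0 \<le> t" "t \<le> 1"
    using PQ unfolding *(3) by (auto simp: cell_edge)
  have "real j + 1 \<le> real r" using *(2) by linarith
  then have "(real j + s) / real r \<in> {0..1}" "(real j + t) / real r \<in> {0..1}"
    using st r_pos by (simp_all add: divide_le_eq)
  from gdist_ept_le[OF *(1) this]
  have "gdist G (coarse P) (coarse Q) \<le> \<bar>s - t\<bar> / real r"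
    unfolding st(1,4) coarse_ept[OF *(1,2)] by (simp flip: diff_divide_distrib)
  then show ?thesis
    using r_pos unfolding st(1,4) H.seg_length_ept[OF edges_HI[OF *(1,2)]]
    by (simp add: le_divide_eq mult.commute)
qed

lemma graph_delta_subdivide: "graph_delta H = real r * graph_delta G"
proof (rule graph_delta_similar[where \<Phi> = fine and \<Psi> = coarse])
  show "metric_graph G" "metric_graph H" by unfold_locales
  show "0 < real r" using r_pos by simp
  show "fine ` points G \<subseteq> points H" "coarse ` points H \<subseteq> points G"
    using fine_points(1) coarse_points(1) by blast+
qed (fact fine_points(2) coarse_points(2) fine_lipschitz coarse_lipschitz)+

end

section \<open>The order of the subdivision\<close>

lemma (in metric_graph) finite_edges: "finite (edges G)"
  by (rule finite_subset[of _ "Pow (verts G)"]) (use edge_subset in auto)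

text \<open>The linear order orients each edge from \<open>Min e\<close> to \<open>Max e\<close>, so
  that an inner grid point, readable from either end, is named by one edge and one index from 1 to
  \<open>r - 1\<close>.\<close>

lemma card_verts_subdivide:
  fixes G :: "'a :: linorder sgraph"
  assumes "subdivision G r"
  shows "card (verts (subdivide r G)) \<le> card (verts G) + (r - 1) * card (edges G)"
proof -
  interpret subdivision G r by fact
  let ?f = "\<lambda>(e, j). gridpt (Min e) (Max e) j" and ?E = "edges G \<times> {1..<r}"
  have "verts H \<subseteq> vpt ` verts G \<union> ?f ` ?E"
  proof
    fix p assume "p \<in> verts H"
    then obtain u v j where *: "{u, v} \<in> edges G" "j \<le> r" "p = gridpt u v j" by (rule verts_HE)
    note uv = edge_verts[OF *(1)]
    show "p \<in> vpt ` verts G \<union> ?f ` ?E"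
    proof (cases "j = 0 \<or> j = r")
      case True
      then show ?thesis using * uv gridpt_r[OF *(1)] by auto
    next
      case False
      show ?thesis
      proof (cases "u < v")
        case True
        then have "p = ?f ({u, v}, j)" using * by simp
        moreover have "({u, v}, j) \<in> ?E" using *(1,2) False by auto
        ultimately show ?thesis by (intro UnI2) (rule image_eqI)
      next
        case F: False
        then have "v < u" using uv(3) by simp
        moreover have "p = gridpt v u (r - j)" using gridpt_sym[of v u j] * by (simp add: insert_commute)
        ultimately have "p = ?f ({u, v}, r - j)" by simp
        moreover have "({u, v}, r - j) \<in> ?E" using *(1,2) False by auto
        ultimately show ?thesis by (intro UnI2) (rule image_eqI)
      qed
    qed
  qed
  then have "card (verts H) \<le> card (vpt ` verts G \<union> ?f ` ?E)"
    using finite_edges by (intro card_mono) auto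
  also have "\<dots> \<le> card (vpt ` verts G) + card (?f ` ?E)" by (rule card_Un_le)
  also have "\<dots> \<le> card (verts G) + card ?E"
    using finite_edges by (intro add_mono card_image_le) auto
  also have "card ?E = (r - 1) * card (edges G)" by (simp add: card_cartesian_product)
  finally show ?thesis .
qed

subsection \<open>Cycle lengths\<close>

text \<open>Girth and circumference are both read off this set, so the effect of each construction
  on cycles becomes a single set equation.\<close>

definition cycle_lengths :: "'a sgraph \<Rightarrow> nat set" where
  "cycle_lengths G = {length vs | vs. is_cycle G vs}"

text \<open>A cycle as a periodic sequence, so that it can be shifted freely.\<close>

definition cyclic_walk :: "'a sgraph \<Rightarrow> nat \<Rightarrow> (nat \<Rightarrow> 'a) \<Rightarrow> bool" where
  "cyclic_walk G L w \<longleftrightarrow> 3 \<le> L \<and> (\<forall>i. {w i, w (Suc i)} \<in> edges G) \<and>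
     (\<forall>i j. w i = w j \<longleftrightarrow> i mod L = j mod L)"

lemma cyclic_walkD:
  assumes "cyclic_walk G L w"
  shows "3 \<le> L" "{w i, w (Suc i)} \<in> edges G" "w i = w j \<longleftrightarrow> i mod L = j mod L"
  using assms unfolding cyclic_walk_def by blast+

text \<open>A cycle length is at least 3 and hence does not divide 2. This is the only way in which
  simplicity of cycles excludes traversing an edge back and forth.\<close>

lemma cyclic_walk_no_backtracking:
  assumes w: "cyclic_walk G L w"
  shows "w (Suc (Suc i)) \<noteq> w i"
proof
  assume "w (Suc (Suc i)) = w i"
  then have "(i + 2) mod L = i mod L" by (simp add: cyclic_walkD(3)[OF w])
  then have "L dvd 2" using mod_eq_dvd_iff_nat[of i "i + 2" L] by simp
  then have "L \<le> 2" by (rule dvd_imp_le) simp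
  then show False using cyclic_walkD(1)[OF w] by simp
qed

lemma cycle_lengths_iff: "L \<in> cycle_lengths G \<longleftrightarrow> (\<exists>w. cyclic_walk G L w)"
proof
  assume "L \<in> cycle_lengths G"
  then obtain vs where vs: "is_cycle G vs" "length vs = L" unfolding cycle_lengths_def by blast
  then have L: "3 \<le> L" "distinct vs" and e: "{vs ! i, vs ! (Suc i mod L)} \<in> edges G" if "i < L" for i
    using that unfolding is_cycle_def by auto
  have L3: "3 \<le> L" "distinct vs" using vs unfolding is_cycle_def by auto
  have "cyclic_walk G L (\<lambda>i. vs ! (i mod L))"
    unfolding cyclic_walk_def
  proof (intro conjI allI)
    fix i j
    show "{vs ! (i mod L), vs ! (Suc i mod L)} \<in> edges G"
      using e[of "i mod L"] L3(1) by (simp add: mod_Suc_eq)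
    show "(vs ! (i mod L) = vs ! (j mod L)) = (i mod L = j mod L)"
      using L3 vs(2) by (intro nth_eq_iff_index_eq) auto
  qed (rule L3(1))
  then show "\<exists>w. cyclic_walk G L w" by (rule exI[of _ "\<lambda>i. vs ! (i mod L)"])
next
  assume "\<exists>w. cyclic_walk G L w"
  then obtain w where w: "cyclic_walk G L w" ..
  have "is_cycle G (map w [0..<L])"
    unfolding is_cycle_def
  proof (intro conjI allI impI)
    show "3 \<le> length (map w [0..<L])" using cyclic_walkD(1)[OF w] by simp
    have "inj_on w {0..<L}" by (rule inj_onI) (simp add: cyclic_walkD(3)[OF w])
    then show "distinct (map w [0..<L])" by (simp add: distinct_map)
    fix i assume "i < length (map w [0..<L])"
    then have i: "i < L" "Suc i mod L < L" by simp_all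
    have "w (Suc i mod L) = w (Suc i)" by (simp add: cyclic_walkD(3)[OF w])
    then show "{map w [0..<L] ! i, map w [0..<L] ! (Suc i mod length (map w [0..<L]))} \<in> edges G"
      using i cyclic_walkD(2)[OF w, of i] by simp
  qed
  then show "L \<in> cycle_lengths G" unfolding cycle_lengths_def by force
qed

lemma girth_eq_iff: "girth G = enat g \<longleftrightarrow> g \<in> cycle_lengths G \<and> (\<forall>k\<in>cycle_lengths G. g \<le> k)"
proof -
  have *: "girth G = Inf (enat ` cycle_lengths G)"
    unfolding girth_def cycle_lengths_def by (rule arg_cong[of _ _ Inf]) blast
  show ?thesis
  proof
    assume g: "girth G = enat g"
    then have "enat ` cycle_lengths G \<noteq> {}" unfolding * by (auto simp: Inf_enat_def)
    then have "Inf (enat ` cycle_lengths G) \<in> enat ` cycle_lengths G"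
      unfolding Inf_enat_def using LeastI_ex[of "\<lambda>x. x \<in> enat ` cycle_lengths G"] by auto
    moreover have "enat g \<le> enat k" if "k \<in> cycle_lengths G" for k
      using that g unfolding * by (metis Inf_lower imageI)
    ultimately show "g \<in> cycle_lengths G \<and> (\<forall>k\<in>cycle_lengths G. g \<le> k)"
      using g unfolding * by auto
  next
    assume "g \<in> cycle_lengths G \<and> (\<forall>k\<in>cycle_lengths G. g \<le> k)"
    then show "girth G = enat g"
      unfolding * by (intro antisym Inf_lower Inf_greatest) auto
  qed
qed

text \<open>Nonemptiness is assumed because an acyclic graph has circumference 0, which is finite
  but not the length of a cycle. For the girth the acyclic case excludes itself, its value being
  infinite.\<close>

lemma circumference_eq_iff:
  assumes "cycle_lengths G \<noteq> {}"
  shows "circumference G = enat c \<longleftrightarrow> c \<in> cycle_lengths G \<and> (\<forall>k\<in>cycle_lengths G. k \<le> c)"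
proof -
  have *: "circumference G = Sup (enat ` cycle_lengths G)"
    unfolding circumference_def cycle_lengths_def by (rule arg_cong[of _ _ Sup]) blast
  show ?thesis
  proof
    assume c: "circumference G = enat c"
    \<comment> \<open>An infinite set of extended naturals has supremum \<open>\<infinity>\<close>,
      so here the supremum is a maximum.\<close>
    then have "finite (enat ` cycle_lengths G)" "Max (enat ` cycle_lengths G) = enat c"
      using assms unfolding * by (auto simp: Sup_enat_def split: if_splits)
    then have "enat c \<in> enat ` cycle_lengths G" using assms by (metis Max_in image_is_empty)
    moreover have "enat k \<le> enat c" if "k \<in> cycle_lengths G" for k
      using that c unfolding * by (metis Sup_upper imageI)
    ultimately show "c \<in> cycle_lengths G \<and> (\<forall>k\<in>cycle_lengths G. k \<le> c)" by auto
  next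
    assume "c \<in> cycle_lengths G \<and> (\<forall>k\<in>cycle_lengths G. k \<le> c)"
    then show "circumference G = enat c"
      unfolding * by (intro antisym Sup_upper Sup_least) auto
  qed
qed

lemma (in metric_graph) cycle_lengths_le_relabel:
  assumes inj: "inj_on f (verts G)"
  shows "cycle_lengths G \<subseteq> cycle_lengths (relabel f G)"
proof
  fix L assume "L \<in> cycle_lengths G"
  then obtain w where w: "cyclic_walk G L w" unfolding cycle_lengths_iff ..
  have "w i \<in> verts G" for i using edge_verts(1)[OF cyclic_walkD(2)[OF w]] .
  then have "f (w i) = f (w j) \<longleftrightarrow> w i = w j" for i j using inj by (simp add: inj_on_eq_iff)
  moreover have "{f (w i), f (w (Suc i))} \<in> edges (relabel f G)" for i
    using imageI[OF cyclic_walkD(2)[OF w, of i], of "(`) f"] by (simp add: relabel_def)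
  ultimately have "cyclic_walk (relabel f G) L (\<lambda>i. f (w i))"
    using cyclic_walkD[OF w] unfolding cyclic_walk_def by simp
  then show "L \<in> cycle_lengths (relabel f G)"
    unfolding cycle_lengths_iff by (rule exI[of _ "\<lambda>i. f (w i)"])
qed

lemma (in metric_graph) cycle_lengths_relabel:
  assumes inj: "inj_on f (verts G)"
  shows "cycle_lengths (relabel f G) = cycle_lengths G"
proof (rule antisym)
  interpret H: metric_graph "relabel f G" by (rule metric_graph_relabel[OF inj])
  let ?f' = "inv_into (verts G) f"
  have inv: "?f' ` f ` S = S" if "S \<subseteq> verts G" for S
    by (rule inv_into_image_cancel[OF inj that])
  have "(`) ?f' ` (`) f ` edges G = (\<lambda>e. e) ` edges G"
    unfolding image_image[of "(`) ?f'"] by (rule image_cong) (use inv[OF edge_subset] in auto)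
  then have "relabel ?f' (relabel f G) = G"
    using inv[OF order_refl] by (simp add: relabel_def)
  moreover have "inj_on ?f' (verts (relabel f G))"
    by (simp add: relabel_def inj_on_inv_into)
  ultimately show "cycle_lengths (relabel f G) \<subseteq> cycle_lengths G"
    using H.cycle_lengths_le_relabel by metis
qed (rule cycle_lengths_le_relabel[OF inj])

section \<open>Cycles of the subdivision\<close>

context subdivision
begin

lemma gridpt_support:
  assumes "{u, v} \<in> edges G" "j < r"
  shows "{x. gridpt u v j x \<noteq> 0} = (if j = 0 then {u} else {u, v})"
  using edge_verts(3)[OF assms(1)] assms(2) by (auto simp: gridpt_def ept_def vpt_def)

text \<open>The support of a grid point reveals its edge, or its vertex if the index is 0. What
  remains open is the direction in which the edge is read. Restricting indices to values below
  \<open>r\<close> lets an original vertex appear only with index 0.\<close>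

lemma gridpt_eqD:
  assumes e: "{u, v} \<in> edges G" "j < r" "{u', v'} \<in> edges G" "j' < r"
    and eq: "gridpt u v j = gridpt u' v' j'"
  shows "j = 0 \<and> j' = 0 \<and> u = u' \<or> j = j' \<and> u = u' \<and> v = v' \<or> j + j' = r \<and> u = v' \<and> v = u'"
proof -
  note ne = edge_verts(3)[OF e(1)] edge_verts(3)[OF e(3)]
  have supp: "(if j = 0 then {u} else {u, v}) = (if j' = 0 then {u'} else {u', v'})"
    using gridpt_support[OF e(1,2)] gridpt_support[OF e(3,4)] eq by simp
  show ?thesis
  proof (cases "j = 0 \<or> j' = 0")
    case True
    then show ?thesis using supp ne by (auto split: if_splits)
  next
    case False
    then consider "u = u'" "v = v'" | "u = v'" "v = u'" using supp by (auto simp: doubleton_eq_iff)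
    then show ?thesis
    proof cases
      case 1
      then show ?thesis using eq gridpt_eq_iff[OF e(1)] by simp
    next
      case 2
      have "gridpt u v j = gridpt u v (r - j')" using eq 2 gridpt_sym[OF e(1), of j'] e(4) by simp
      then have "j = r - j'" using gridpt_eq_iff[OF e(1)] by simp
      then show ?thesis using 2 e(4) by simp
    qed
  qed
qed

lemma edges_H_oriented:
  assumes "{p, q} \<in> edges H"
  obtains u v j where "{u, v} \<in> edges G" "j < r" "p = gridpt u v j" "q = gridpt u v (Suc j)"
proof -
  obtain u v j where *: "{u, v} \<in> edges G" "j < r" "{p, q} = {gridpt u v j, gridpt u v (Suc j)}"
    by (rule edges_HE[OF assms])
  then consider "p = gridpt u v j" "q = gridpt u v (Suc j)"
    | "p = gridpt u v (Suc j)" "q = gridpt u v j"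
    by (auto simp: doubleton_eq_iff)
  then show ?thesis
  proof cases
    case 1
    then show ?thesis using that * by blast
  next
    case 2
    have e: "{v, u} \<in> edges G" using *(1) by (simp add: insert_commute)
    have "Suc (r - Suc j) = r - j" using *(2) by simp
    then have "p = gridpt v u (r - Suc j)" "q = gridpt v u (Suc (r - Suc j))"
      using 2 *(2) gridpt_sym[OF e, of "Suc j"] gridpt_sym[OF e, of j] by simp_all
    then show ?thesis using that[OF e, of "r - Suc j"] *(2) by simp
  qed
qed

text \<open>By \<open>gridpt_eqD\<close>, every edge of \<open>H\<close> at an inner grid point
  comes from the same edge of \<open>G\<close>, read in one of its two directions. So inner grid
  points have degree two.\<close>

lemma neighbour_interior:
  assumes e: "{u, v} \<in> edges G" and j: "0 < j" "j < r" and adj: "{gridpt u v j, q} \<in> edges H"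
  shows "q = gridpt u v (j - 1) \<or> q = gridpt u v (Suc j)"
proof -
  obtain u' v' j' where *: "{u', v'} \<in> edges G" "j' < r" "gridpt u v j = gridpt u' v' j'"
    "q = gridpt u' v' (Suc j')" by (rule edges_H_oriented[OF adj])
  consider "j = j'" "u = u'" "v = v'" | "j + j' = r" "u = v'" "v = u'"
    using gridpt_eqD[OF e j(2) *(1-3)] j(1) by auto
  then show ?thesis
  proof cases
    case 1
    then show ?thesis using *(4) by simp
  next
    case 2
    then have "q = gridpt u v (r - Suc j')" using *(2,4) gridpt_sym[OF e, of "Suc j'"] by simp
    moreover have "r - Suc j' = j - 1" using 2(1) by simp
    ultimately show ?thesis by simp
  qed
qed

text \<open>A cycle cannot turn back inside a subdivided edge, so it runs through to the end.\<close>

lemma cyclic_walk_along_edge: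
  assumes w: "cyclic_walk H L w" and e: "{u, v} \<in> edges G"
    and start: "w a = gridpt u v j" "w (Suc a) = gridpt u v (Suc j)"
  shows "j + i \<le> r \<Longrightarrow> w (a + i) = gridpt u v (j + i)"
proof (induction i rule: less_induct)
  case (less i)
  show ?case
  proof (cases "i < 2")
    case True
    then have "i = 0 \<or> i = 1" by linarith
    then show ?thesis using start by auto
  next
    case False
    then obtain k where k: "i = Suc (Suc k)" by (metis add_2_eq_Suc le_add_diff_inverse not_less)
    have p: "w (a + k) = gridpt u v (j + k)" "w (a + Suc k) = gridpt u v (j + Suc k)"
      using less.IH[of k] less.IH[of "Suc k"] less.prems k by simp_all
    have "{gridpt u v (j + Suc k), w (a + i)} \<in> edges H"
      using cyclic_walkD(2)[OF w, of "a + Suc k"] p(2) k by simp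
    then consider "w (a + i) = gridpt u v (j + k)" | "w (a + i) = gridpt u v (j + i)"
      using neighbour_interior[OF e, of "j + Suc k"] less.prems k by auto
    then show ?thesis
    proof cases
      case 1
      then show ?thesis using cyclic_walk_no_backtracking[OF w, of "a + k"] p(1) k by simp
    qed
  qed
qed

text \<open>At time \<open>m\<close> the lifted cycle is on the edge number \<open>m div r\<close>,
  at position \<open>m mod r\<close>. The delicate point is injectivity, since an inner grid point
  could be met from both directions.\<close>

lemma cycle_lengths_subdivide_ge:
  assumes "k \<in> cycle_lengths G"
  shows "r * k \<in> cycle_lengths H"
proof -
  obtain v where v: "cyclic_walk G k v" using assms unfolding cycle_lengths_iff ..
  note v3 = cyclic_walkD(1)[OF v] and ve = cyclic_walkD(2)[OF v] and vi = cyclic_walkD(3)[OF v]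
  define w where "w m = gridpt (v (m div r)) (v (Suc (m div r))) (m mod r)" for m
  have mr: "m mod r < r" for m using r_pos by simp
  have "{w m, w (Suc m)} \<in> edges H" for m
  proof -
    have "w (Suc m) = gridpt (v (m div r)) (v (Suc (m div r))) (Suc (m mod r))"
    proof (cases "Suc (m mod r) = r")
      case True
      then show ?thesis using gridpt_r[OF ve] by (simp add: w_def mod_Suc div_Suc)
    next
      case False
      then show ?thesis by (simp add: w_def mod_Suc div_Suc)
    qed
    then show ?thesis using edges_HI[OF ve mr] by (simp add: w_def)
  qed
  moreover have "w m = w m' \<longleftrightarrow> m mod (r * k) = m' mod (r * k)" for m m'
  proof
    assume "m mod (r * k) = m' mod (r * k)"
    then have eq: "r * (m div r mod k) + m mod r = r * (m' div r mod k) + m' mod r"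
      by (simp add: mod_mult2_eq)
    from arg_cong[OF eq, of "\<lambda>x. x mod r"] arg_cong[OF eq, of "\<lambda>x. x div r"]
    have "m mod r = m' mod r" "m div r mod k = m' div r mod k" using r_pos by simp_all
    moreover from this(2) have "Suc (m div r) mod k = Suc (m' div r) mod k" by (metis mod_Suc_eq)
    ultimately have "v (m div r) = v (m' div r)" "v (Suc (m div r)) = v (Suc (m' div r))"
      by (simp_all add: vi)
    then show "w m = w m'" using \<open>m mod r = m' mod r\<close> by (simp add: w_def)
  next
    assume "w m = w m'"
    then consider "m mod r = m' mod r" "v (m div r) = v (m' div r)"
      | "v (m div r) = v (Suc (m' div r))" "v (Suc (m div r)) = v (m' div r)"
      using gridpt_eqD[OF ve[of "m div r"] mr[of m] ve[of "m' div r"] mr[of m']] unfolding w_def by auto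
    then show "m mod (r * k) = m' mod (r * k)"
    proof cases
      case 1
      then show ?thesis by (simp add: mod_mult2_eq vi)
    next
      case 2
      \<comment> \<open>Both times lie on one edge traversed in opposite directions; the cycle in
        \<open>G\<close> would return to the same vertex after two steps.\<close>
      have "Suc (m div r) mod k = Suc (Suc (m' div r)) mod k" using 2(1) by (metis vi mod_Suc_eq)
      then have "v (Suc (Suc (m' div r))) = v (m' div r)" using 2(2) by (simp flip: vi)
      then show ?thesis using cyclic_walk_no_backtracking[OF v] by blast
    qed
  qed
  moreover have "3 \<le> r * k" using v3 r_pos mult_le_mono[of 1 r 3 k] by simp
  ultimately have "cyclic_walk H (r * k) w" unfolding cyclic_walk_def by blast
  then show ?thesis unfolding cycle_lengths_iff by (rule exI[of _ w])
qed

text \<open>Once shifted to start at an original vertex, a cycle of \<open>H\<close> traverses whole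
  edges of \<open>G\<close>. It meets original vertices exactly at multiples of \<open>r\<close>,
  and these form the cycle in \<open>G\<close>.\<close>

lemma cycle_lengths_subdivide_le:
  assumes "L \<in> cycle_lengths H"
  shows "\<exists>k\<in>cycle_lengths G. L = r * k"
proof -
  obtain w0 where w0: "cyclic_walk H L w0" using assms unfolding cycle_lengths_iff ..
  obtain u0 v0 j0 where s: "{u0, v0} \<in> edges G" "j0 < r" "w0 0 = gridpt u0 v0 j0"
    "w0 (Suc 0) = gridpt u0 v0 (Suc j0)" by (rule edges_H_oriented[OF cyclic_walkD(2)[OF w0, of 0]])
  \<comment> \<open>The number of steps to the end of the edge on which the cycle starts.\<close>
  define a where "a = r - j0"
  have a: "w0 a = vpt v0"
    using cyclic_walk_along_edge[OF w0 s(1,3,4), of a] s(2) gridpt_r[OF s(1)] by (simp add: a_def)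
  define w where "w i = w0 (a + i)" for i
  have w: "cyclic_walk H L w"
    unfolding cyclic_walk_def
  proof (intro conjI allI)
    fix i j
    show "3 \<le> L" by (rule cyclic_walkD(1)[OF w0])
    show "{w i, w (Suc i)} \<in> edges H" using cyclic_walkD(2)[OF w0, of "a + i"] by (simp add: w_def)
    show "(w i = w j) = (i mod L = j mod L)"
      unfolding w_def cyclic_walkD(3)[OF w0] by (simp add: nat_mod_eq_iff)
  qed
  \<comment> \<open>A step out of an original vertex has index 0 on its edge, so the following
    \<open>r\<close> steps cover that edge.\<close>
  have leg: "\<exists>v. {u, v} \<in> edges G \<and> (\<forall>j\<le>r. w (b + j) = gridpt u v j)"
    if b: "w b = vpt u" and u: "u \<in> verts G" for b u
  proof -
    obtain x where x: "{u, x} \<in> edges G" using neighbour_exists[OF u] by blast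
    obtain u' v' j' where *: "{u', v'} \<in> edges G" "j' < r" "w b = gridpt u' v' j'"
      "w (Suc b) = gridpt u' v' (Suc j')" by (rule edges_H_oriented[OF cyclic_walkD(2)[OF w, of b]])
    have "gridpt u x 0 = gridpt u' v' j'" using b *(3) by simp
    then have "j' = 0" "u' = u" using gridpt_eqD[OF x r_pos *(1,2)] *(2) by auto
    then show ?thesis using cyclic_walk_along_edge[OF w *(1,3,4)] *(1) by auto
  qed
  have "\<exists>u\<in>verts G. w (r * i) = vpt u" for i
  proof (induction i)
    case 0
    then show ?case using a edge_verts(2)[OF s(1)] by (auto simp: w_def)
  next
    case (Suc i)
    then obtain u where u: "u \<in> verts G" "w (r * i) = vpt u" by blast
    obtain v where v: "{u, v} \<in> edges G" "\<forall>j\<le>r. w (r * i + j) = gridpt u v j"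
      using leg[OF u(2,1)] by blast
    have "w (r * Suc i) = vpt v" using v(2) gridpt_r[OF v(1)] by (auto simp: add.commute)
    then show ?case using edge_verts(2)[OF v(1)] by blast
  qed
  then obtain x where x: "\<And>i. x i \<in> verts G" "\<And>i. w (r * i) = vpt (x i)" by metis
  have vpt_inj: "y = z" if "vpt y = vpt z" for y z :: 'a
    using that unfolding vpt_def fun_eq_iff by (metis zero_neq_one)
  have xe: "{x i, x (Suc i)} \<in> edges G" and xw: "j \<le> r \<Longrightarrow> w (r * i + j) = gridpt (x i) (x (Suc i)) j" for i j
  proof -
    obtain v where v: "{x i, v} \<in> edges G" "\<forall>j\<le>r. w (r * i + j) = gridpt (x i) v j"
      using leg[OF x(2,1)] by blast
    have "vpt (x (Suc i)) = vpt v"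
      using v(2) gridpt_r[OF v(1)] x(2)[of "Suc i"] by (auto simp: add.commute)
    then have "x (Suc i) = v" by (rule vpt_inj)
    then show "{x i, x (Suc i)} \<in> edges G" "j \<le> r \<Longrightarrow> w (r * i + j) = gridpt (x i) (x (Suc i)) j"
      using v by auto
  qed
  define q where "q = L div r"
  have mr: "L mod r < r" using r_pos by simp
  \<comment> \<open>After \<open>L\<close> steps the cycle is back at an original vertex, which no
    position strictly between multiples of \<open>r\<close> can be.\<close>
  have "gridpt (x 0) (x 1) 0 = w L"
    using x(2)[of 0] cyclic_walkD(3)[OF w, of 0 L] by simp
  also have "w L = gridpt (x q) (x (Suc q)) (L mod r)"
    using xw[of "L mod r" q] mr by (simp add: q_def)
  finally have "L mod r = 0" using gridpt_eqD[OF _ r_pos xe mr, of "x 0" "x 1" q] xe[of 0] mr by auto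
  then have L: "L = r * q" by (auto simp: q_def)
  have xi: "x i = x j \<longleftrightarrow> i mod q = j mod q" for i j
  proof -
    have "x i = x j \<longleftrightarrow> w (r * i) = w (r * j)" using x(2) vpt_inj by metis
    also have "\<dots> \<longleftrightarrow> r * (i mod q) = r * (j mod q)"
      unfolding cyclic_walkD(3)[OF w] L by (simp only: mult_mod_right)
    finally show ?thesis using r_pos by simp
  qed
  \<comment> \<open>A quotient of 1 would give a loop in \<open>G\<close>. A quotient of 2 would
    mean going along an edge and back: positions 1 and \<open>r + (r - 1)\<close> coincide, which
    forces \<open>r = 1\<close> and thus a cycle of length 2.\<close>
  have "3 \<le> q"
  proof (rule ccontr)
    assume "\<not> 3 \<le> q"
    moreover have "q \<noteq> 0" using cyclic_walkD(1)[OF w] L by (cases q) auto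
    ultimately consider "q = 1" | "q = 2" by linarith
    then show False
    proof cases
      case 1
      then have "x 0 = x (Suc 0)" by (simp add: xi)
      then show False using edge_verts(3)[OF xe[of 0]] by simp
    next
      case 2
      have "x 2 = x 0" using xi[of 2 0] 2 by simp
      then have "w (r * 1 + (r - 1)) = gridpt (x 1) (x 0) (r - 1)"
        using xw[of "r - 1" 1] by (simp add: numeral_2_eq_2)
      also have "\<dots> = gridpt (x 0) (x 1) 1"
        using gridpt_sym[of "x 0" "x 1" "r - 1"] xe[of 0] r_pos by simp
      also have "\<dots> = w 1" using xw[of 1 0] r_pos by simp
      finally have "(r + (r - 1)) mod L = 1 mod L" unfolding cyclic_walkD(3)[OF w] by simp
      moreover have "r + (r - 1) < L" using L 2 r_pos by simp
      ultimately have "r = 1" using cyclic_walkD(1)[OF w] by simp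
      then show False using L 2 cyclic_walkD(1)[OF w] by simp
    qed
  qed
  then have "cyclic_walk G q x" unfolding cyclic_walk_def using xe xi by blast
  then have "q \<in> cycle_lengths G" unfolding cycle_lengths_iff by (rule exI[of _ x])
  then show ?thesis using L by blast
qed

lemma cycle_lengths_subdivide: "cycle_lengths H = (*) r ` cycle_lengths G"
  using cycle_lengths_subdivide_ge cycle_lengths_subdivide_le by blast

end

subsection \<open>Pendant edges\<close>

text \<open>\<open>M'\<close> is \<open>M\<close> with a segment glued on at the point \<open>w\<close>: \<open>h\<close> is the height above \<open>M\<close> and
  \<open>\<rho>\<close> the retraction that collapses the segment.\<close>

locale pendant_space =
  fixes M M' :: "'p set" and d d' :: "'p \<Rightarrow> 'p \<Rightarrow> real" and h :: "'p \<Rightarrow> real" and \<rho> :: "'p \<Rightarrow> 'p"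
    and w :: 'p and K :: real
  assumes d_nonneg: "\<And>p q. p \<in> M \<Longrightarrow> q \<in> M \<Longrightarrow> 0 \<le> d p q"
    and d_refl: "\<And>p. p \<in> M \<Longrightarrow> d p p = 0"
    and d_sym: "\<And>p q. p \<in> M \<Longrightarrow> q \<in> M \<Longrightarrow> d p q = d q p"
    and d_triangle: "\<And>p q s. p \<in> M \<Longrightarrow> q \<in> M \<Longrightarrow> s \<in> M \<Longrightarrow> d p s \<le> d p q + d q s"
    and d_zero: "\<And>p q. p \<in> M \<Longrightarrow> q \<in> M \<Longrightarrow> d p q = 0 \<Longrightarrow> p = q"
    and d_bound: "\<And>p q. p \<in> M \<Longrightarrow> q \<in> M \<Longrightarrow> d p q \<le> K"
    and w: "w \<in> M" and M_sub: "M \<subseteq> M'"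
    and \<rho>_M: "\<And>p. p \<in> M' \<Longrightarrow> \<rho> p \<in> M"
    and d': "\<And>p q. p \<in> M' \<Longrightarrow> q \<in> M' \<Longrightarrow> d' p q = \<bar>h p - h q\<bar> + d (\<rho> p) (\<rho> q)"
    and h_nonneg: "\<And>p. p \<in> M' \<Longrightarrow> 0 \<le> h p"
    and h_or_\<rho>: "\<And>p. p \<in> M' \<Longrightarrow> h p = 0 \<or> \<rho> p = w"
    and h_M: "\<And>p. p \<in> M \<Longrightarrow> h p = 0"
    and \<rho>_id: "\<And>p. p \<in> M' \<Longrightarrow> h p = 0 \<Longrightarrow> \<rho> p = p"
    and h_\<rho>_inj: "\<And>p q. p \<in> M' \<Longrightarrow> q \<in> M' \<Longrightarrow> h p = h q \<Longrightarrow> \<rho> p = \<rho> q \<Longrightarrow> p = q"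
begin

lemma d'_nonneg: "p \<in> M' \<Longrightarrow> q \<in> M' \<Longrightarrow> 0 \<le> d' p q"
  by (simp add: d' d_nonneg \<rho>_M)

lemma d'_sym: "p \<in> M' \<Longrightarrow> q \<in> M' \<Longrightarrow> d' p q = d' q p"
  by (simp add: d' d_sym \<rho>_M abs_minus_commute)

lemma d'_refl: "p \<in> M' \<Longrightarrow> d' p p = 0"
  by (simp add: d' d_refl \<rho>_M)

text \<open>Equality in the triangle inequality of an \<open>\<ell>\<^sub>1\<close>-sum forces equality in both summands.\<close>

lemma between_split:
  assumes "p \<in> M'" "q \<in> M'" "s \<in> M'" "d' p s = d' p q + d' q s"
  shows "\<bar>h p - h s\<bar> = \<bar>h p - h q\<bar> + \<bar>h q - h s\<bar>"
    "d (\<rho> p) (\<rho> s) = d (\<rho> p) (\<rho> q) + d (\<rho> q) (\<rho> s)"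
  using assms d_triangle[OF assms(1-3)[THEN \<rho>_M]] by (auto simp: d')

text \<open>A point of a geodesic is metrically between the ends, and \<open>between_split\<close>
  passes this on to heights.\<close>

lemma geodesic_height_between:
  assumes S: "geodesic_segment M' d' a b S" and ab: "a \<in> M'" "b \<in> M'" and p: "p \<in> S"
  shows "min (h a) (h b) \<le> h p" "h p \<le> max (h a) (h b)"
proof -
  obtain \<gamma> where \<gamma>: "\<gamma> 0 = a" "\<gamma> (d' a b) = b" "\<gamma> ` {0..d' a b} = S" "S \<subseteq> M'"
    "\<forall>s\<in>{0..d' a b}. \<forall>t\<in>{0..d' a b}. d' (\<gamma> s) (\<gamma> t) = \<bar>s - t\<bar>"
    by (rule geodesic_segmentE[OF S])
  obtain t where t: "t \<in> {0..d' a b}" "p = \<gamma> t" using p \<gamma>(3) by blast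
  have "d' a b = d' a p + d' p b"
    using \<gamma>(1,2) \<gamma>(5)[rule_format, of 0 t] \<gamma>(5)[rule_format, of t "d' a b"] t by simp
  from between_split(1)[OF ab(1) _ ab(2) this] p \<gamma>(4)
  have "\<bar>h a - h b\<bar> = \<bar>h a - h p\<bar> + \<bar>h p - h b\<bar>" by blast
  then show "min (h a) (h b) \<le> h p" "h p \<le> max (h a) (h b)" by linarith+
qed

text \<open>The retracted curve stands still while the geodesic runs in the glued segment, so it has
  to be reparametrised by its distance \<open>\<sigma>\<close> from the start. Betweenness makes
  \<open>\<sigma>\<close> monotone, and it is 1-Lipschitz, hence takes all intermediate
  values.\<close>

lemma geodesic_retract:
  assumes S: "geodesic_segment M' d' a b S" and ab: "a \<in> M'" "b \<in> M'"
  shows "geodesic_segment M d (\<rho> a) (\<rho> b) (\<rho> ` S)"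
proof -
  define l where "l = d' a b"
  have l: "0 \<le> l" using d'_nonneg[OF ab] by (simp add: l_def)
  obtain \<gamma> where \<gamma>: "\<gamma> 0 = a" "\<gamma> l = b" "\<gamma> ` {0..l} = S" "S \<subseteq> M'"
    "\<forall>s\<in>{0..l}. \<forall>t\<in>{0..l}. d' (\<gamma> s) (\<gamma> t) = \<bar>s - t\<bar>"
    unfolding l_def by (rule geodesic_segmentE[OF S])
  have \<gamma>M: "\<gamma> t \<in> M'" if "t \<in> {0..l}" for t using \<gamma>(3,4) that by blast
  define \<sigma> where "\<sigma> t = d (\<rho> a) (\<rho> (\<gamma> t))" for t
  have mono: "d (\<rho> (\<gamma> s)) (\<rho> (\<gamma> t)) = \<sigma> t - \<sigma> s" if "0 \<le> s" "s \<le> t" "t \<le> l" for s t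
  proof -
    have m: "0 \<in> {0..l}" "s \<in> {0..l}" "t \<in> {0..l}" using that by auto
    have "d' (\<gamma> 0) (\<gamma> t) = d' (\<gamma> 0) (\<gamma> s) + d' (\<gamma> s) (\<gamma> t)"
      using \<gamma>(5) m that by simp
    from between_split(2)[OF \<gamma>M[OF m(1)] \<gamma>M[OF m(2)] \<gamma>M[OF m(3)] this]
    show ?thesis by (simp add: \<sigma>_def \<gamma>(1))
  qed
  have dist: "d (\<rho> (\<gamma> s)) (\<rho> (\<gamma> t)) = \<bar>\<sigma> s - \<sigma> t\<bar>" if st: "s \<in> {0..l}" "t \<in> {0..l}" for s t
  proof -
    have M: "\<rho> (\<gamma> s) \<in> M" "\<rho> (\<gamma> t) \<in> M" using \<gamma>M \<rho>_M st by auto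
    show ?thesis
    proof (cases "s \<le> t")
      case True
      then show ?thesis using mono[of s t] st d_nonneg[OF M] by simp
    next
      case False
      then show ?thesis using mono[of t s] st d_nonneg[OF M(2,1)] d_sym[OF M] by simp
    qed
  qed
  have lip: "\<bar>\<sigma> s - \<sigma> t\<bar> \<le> \<bar>s - t\<bar>" if "s \<in> {0..l}" "t \<in> {0..l}" for s t
    using dist[OF that] d'[OF \<gamma>M[OF that(1)] \<gamma>M[OF that(2)]] \<gamma>(5) that by simp
  have cont: "continuous_on {0..l} \<sigma>"
    unfolding continuous_on_def tendsto_iff eventually_at dist_real_def
  proof (intro ballI allI impI)
    fix x e :: real assume "x \<in> {0..l}" "0 < e"
    then show "\<exists>d>0. \<forall>x'\<in>{0..l}. x' \<noteq> x \<and> \<bar>x' - x\<bar> < d \<longrightarrow> \<bar>\<sigma> x' - \<sigma> x\<bar> < e"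
      using lip[OF _ \<open>x \<in> {0..l}\<close>, THEN le_less_trans] by (intro exI[of _ e]) blast
  qed
  have \<sigma>0: "\<sigma> 0 = 0" using d_refl \<rho>_M ab(1) by (simp add: \<sigma>_def \<gamma>(1))
  have \<sigma>l: "\<sigma> l = d (\<rho> a) (\<rho> b)" by (simp add: \<sigma>_def \<gamma>(2))
  have range: "\<sigma> t \<in> {0..\<sigma> l}" if "t \<in> {0..l}" for t
  proof -
    have M: "\<rho> (\<gamma> 0) \<in> M" "\<rho> (\<gamma> t) \<in> M" "\<rho> (\<gamma> l) \<in> M" using \<gamma>M \<rho>_M that l by auto
    show ?thesis
      using mono[of 0 t] mono[of t l] that \<sigma>0 d_nonneg[OF M(1,2)] d_nonneg[OF M(2,3)] by simp
  qed
  \<comment> \<open>A time at which the retracted curve has covered the distance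
    \<open>\<tau>\<close>. All such times give the same retracted point, so the choice is
    immaterial.\<close>
  define T where "T \<tau> = (SOME t. t \<in> {0..l} \<and> \<sigma> t = \<tau>)" for \<tau>
  have T: "T \<tau> \<in> {0..l}" "\<sigma> (T \<tau>) = \<tau>" if \<tau>: "\<tau> \<in> {0..\<sigma> l}" for \<tau>
  proof -
    obtain t where "0 \<le> t" "t \<le> l" "\<sigma> t = \<tau>" using IVT'[of \<sigma> 0 \<tau> l] \<tau> \<sigma>0 l cont by auto
    then have "\<exists>t. t \<in> {0..l} \<and> \<sigma> t = \<tau>" by auto
    from someI_ex[OF this] show "T \<tau> \<in> {0..l}" "\<sigma> (T \<tau>) = \<tau>" by (simp_all add: T_def)
  qed
  have T\<sigma>: "\<rho> (\<gamma> (T (\<sigma> t))) = \<rho> (\<gamma> t)" if "t \<in> {0..l}" for t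
    using that T[OF range[OF that]] dist d_zero \<rho>_M \<gamma>M by (metis abs_zero cancel_comm_monoid_add_class.diff_cancel)
  define g where "g \<tau> = \<rho> (\<gamma> (T \<tau>))" for \<tau>
  show ?thesis
    unfolding geodesic_segment_def \<sigma>l[symmetric]
  proof (intro exI[of _ g] conjI ballI)
    show "g 0 = \<rho> a" using T\<sigma>[of 0] \<sigma>0 l \<gamma>(1) by (simp add: g_def)
    show "g (\<sigma> l) = \<rho> b" using T\<sigma>[of l] l \<gamma>(2) by (simp add: g_def)
    show "\<rho> ` S \<subseteq> M" using \<gamma>(4) \<rho>_M by blast
    show "g ` {0..\<sigma> l} = \<rho> ` S"
    proof
      show "g ` {0..\<sigma> l} \<subseteq> \<rho> ` S" using T(1) \<gamma>(3) unfolding g_def by blast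
      show "\<rho> ` S \<subseteq> g ` {0..\<sigma> l}"
      proof
        fix p assume "p \<in> \<rho> ` S"
        then obtain t where t: "t \<in> {0..l}" "p = \<rho> (\<gamma> t)" using \<gamma>(3) by blast
        then have "p = g (\<sigma> t)" using T\<sigma> by (simp add: g_def)
        then show "p \<in> g ` {0..\<sigma> l}" using range[OF t(1)] by (rule image_eqI)
      qed
    qed
    fix \<tau> \<tau>' assume "\<tau> \<in> {0..\<sigma> l}" "\<tau>' \<in> {0..\<sigma> l}"
    then show "d (g \<tau>) (g \<tau>') = \<bar>\<tau> - \<tau>'\<bar>" using dist T by (simp add: g_def)
  qed
qed

text \<open>The start \<open>a\<close> lies above \<open>M\<close>, so the geodesic can only leave
  the segment by descending through it. At time \<open>h a - h p\<close> the whole distance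
  travelled is accounted for by the descent, which identifies the point as \<open>p\<close>.\<close>

lemma geodesic_covers_heights_decreasing:
  assumes S: "geodesic_segment M' d' a b S" and ab: "a \<in> M'" "b \<in> M'"
    and p: "p \<in> M'" "\<rho> p = w" "h b \<le> h p" "h p \<le> h a" "0 < h a"
  shows "p \<in> S"
proof -
  obtain \<gamma> where \<gamma>: "\<gamma> 0 = a" "\<gamma> (d' a b) = b" "\<gamma> ` {0..d' a b} = S" "S \<subseteq> M'"
    "\<forall>s\<in>{0..d' a b}. \<forall>t\<in>{0..d' a b}. d' (\<gamma> s) (\<gamma> t) = \<bar>s - t\<bar>"
    by (rule geodesic_segmentE[OF S])
  have \<rho>a: "\<rho> a = w" using h_or_\<rho>[OF ab(1)] p(5) by simp
  define t where "t = h a - h p"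
  have "0 \<le> d (\<rho> a) (\<rho> b)" using d_nonneg \<rho>_M ab by simp
  then have t: "t \<in> {0..d' a b}" using d'[OF ab] p by (simp add: t_def)
  then have xS: "\<gamma> t \<in> S" using \<gamma>(3) by blast
  then have x: "\<gamma> t \<in> M'" using \<gamma>(4) by blast
  have "d' a (\<gamma> t) = t" using \<gamma>(1) \<gamma>(5)[rule_format, of 0 t] t by simp
  then have *: "\<bar>h a - h (\<gamma> t)\<bar> + d w (\<rho> (\<gamma> t)) = h a - h p"
    using d'[OF ab(1) x] \<rho>a by (simp add: t_def)
  have hx: "h (\<gamma> t) \<le> h a" using geodesic_height_between(2)[OF S ab xS] p by simp
  have dw: "0 \<le> d w (\<rho> (\<gamma> t))" using d_nonneg w \<rho>_M[OF x] by blast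
  have "h (\<gamma> t) = h p \<and> \<rho> (\<gamma> t) = w"
    using h_or_\<rho>[OF x]
  proof
    assume "h (\<gamma> t) = 0"
    then have "h p = 0" "d w (\<rho> (\<gamma> t)) = 0" using * dw h_nonneg[OF p(1)] p(5) by auto
    then show ?thesis using \<open>h (\<gamma> t) = 0\<close> d_zero[OF w \<rho>_M[OF x]] by simp
  next
    assume "\<rho> (\<gamma> t) = w"
    then show ?thesis using * hx d_refl[OF w] by simp
  qed
  then have "\<gamma> t = p" using h_\<rho>_inj[OF x p(1)] p(2) by simp
  then show ?thesis using xS by simp
qed

lemma geodesic_covers_heights:
  assumes S: "geodesic_segment M' d' a b S" and ab: "a \<in> M'" "b \<in> M'"
    and p: "p \<in> M'" "\<rho> p = w" "min (h a) (h b) \<le> h p" "h p \<le> max (h a) (h b)" "0 < max (h a) (h b)"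
  shows "p \<in> S"
proof (cases "h b \<le> h a")
  case True
  then show ?thesis using geodesic_covers_heights_decreasing[OF S ab p(1,2)] p(3-5) by simp
next
  case False
  have "geodesic_segment M' d' b a S" using geodesic_segment_sym[OF S] d'_sym[OF ab] by simp
  from geodesic_covers_heights_decreasing[OF this ab(2,1) p(1,2)] False p(3-5) show ?thesis by simp
qed

text \<open>A raised point of one side lies on another side. For a point of \<open>M\<close>, the
  retracted triangle supplies a nearby \<open>\<rho> q\<close>; if \<open>q\<close> itself is
  raised, then \<open>\<rho> q\<close> is the gluing point \<open>w\<close>, and one of the other
  two sides passes through \<open>w\<close>.\<close>

lemma thin_side:
  assumes xyz: "x \<in> M'" "y \<in> M'" "z \<in> M'"
    and S1: "geodesic_segment M' d' x y S1" and S2: "geodesic_segment M' d' y z S2"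
    and S3: "geodesic_segment M' d' z x S3"
    and thin: "0 \<le> \<epsilon>" "\<rho> ` S1 \<subseteq> nbhd M d \<epsilon> (\<rho> ` S2 \<union> \<rho> ` S3)"
  shows "S1 \<subseteq> nbhd M' d' \<epsilon> (S2 \<union> S3)"
proof
  fix p assume p: "p \<in> S1"
  have pM: "p \<in> M'" using p geodesic_segment_subset[OF S1] by blast
  note hp = geodesic_height_between[OF S1 xyz(1,2) p]
  have "\<exists>q\<in>S2 \<union> S3. d' p q \<le> \<epsilon>"
  proof (cases "h p = 0")
    case False
    then have pos: "0 < h p" and \<rho>p: "\<rho> p = w" using h_nonneg[OF pM] h_or_\<rho>[OF pM] by auto
    \<comment> \<open>The height of \<open>p\<close> is between those of \<open>x\<close> and
      \<open>y\<close>; wherever the height of \<open>z\<close> lies, one of the other sides spans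
      the height of \<open>p\<close> as well.\<close>
    consider "min (h y) (h z) \<le> h p" "h p \<le> max (h y) (h z)" | "min (h z) (h x) \<le> h p" "h p \<le> max (h z) (h x)"
      using hp by linarith
    then have "p \<in> S2 \<union> S3"
    proof cases
      case 1
      then show ?thesis using geodesic_covers_heights[OF S2 xyz(2,3) pM \<rho>p] pos by simp
    next
      case 2
      then show ?thesis using geodesic_covers_heights[OF S3 xyz(3,1) pM \<rho>p] pos by simp
    qed
    then show ?thesis using d'_refl[OF pM] thin(1) by (metis order_refl)
  next
    case True
    then have \<rho>p: "\<rho> p = p" by (rule \<rho>_id[OF pM])
    have "\<rho> p \<in> nbhd M d \<epsilon> (\<rho> ` S2 \<union> \<rho> ` S3)" using p thin(2) by blast
    then obtain q where q: "q \<in> S2 \<union> S3" "d p (\<rho> q) \<le> \<epsilon>" unfolding \<rho>p nbhd_def by blast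
    have qM: "q \<in> M'" using q(1) geodesic_segment_subset[OF S2] geodesic_segment_subset[OF S3] by blast
    show ?thesis
    proof (cases "h q = 0")
      case True
      then have "d' p q = d p (\<rho> q)" using d'[OF pM qM] \<open>h p = 0\<close> \<rho>p by simp
      then show ?thesis using q by (intro bexI[of _ q]) auto
    next
      case False
      then have hq: "0 < h q" and \<rho>q: "\<rho> q = w" using h_nonneg[OF qM] h_or_\<rho>[OF qM] by auto
      have wM: "w \<in> M'" "h w = 0" using w M_sub h_M by auto
      then have \<rho>w: "\<rho> w = w" using \<rho>_id by blast
      have xy0: "h x = 0 \<or> h y = 0"
        using hp(1) \<open>h p = 0\<close> h_nonneg[OF xyz(1)] h_nonneg[OF xyz(2)] by linarith
      note nn = h_nonneg[OF xyz(1)] h_nonneg[OF xyz(2)] h_nonneg[OF xyz(3)]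
      have "0 < h y \<or> 0 < h z \<or> 0 < h x"
        using q(1) geodesic_height_between(2)[OF S2 xyz(2,3), of q]
          geodesic_height_between(2)[OF S3 xyz(3,1), of q] hq by auto
      \<comment> \<open>One of \<open>x\<close>, \<open>y\<close> has height 0 since
        \<open>p\<close> does, and some corner is raised since \<open>q\<close> is. So one of the
        other two sides joins height 0 to a positive height and must cross \<open>w\<close>.\<close>
      then consider "min (h y) (h z) \<le> 0" "0 < max (h y) (h z)" | "min (h z) (h x) \<le> 0" "0 < max (h z) (h x)"
        using xy0 nn by linarith
      then have "w \<in> S2 \<union> S3"
      proof cases
        case 1
        then show ?thesis using geodesic_covers_heights[OF S2 xyz(2,3) wM(1) \<rho>w] wM(2) by simp
      next
        case 2
        then show ?thesis using geodesic_covers_heights[OF S3 xyz(3,1) wM(1) \<rho>w] wM(2) by simp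
      qed
      moreover have "d' p w \<le> \<epsilon>" using d'[OF pM wM(1)] \<open>h p = 0\<close> wM(2) \<rho>p \<rho>w \<rho>q q(2) by simp
      ultimately show ?thesis by blast
    qed
  qed
  then show "p \<in> nbhd M' d' \<epsilon> (S2 \<union> S3)" using pM unfolding nbhd_def by blast
qed

lemma hyp_const_le_retract: "hyp_const M' d' \<le> hyp_const M d"
proof -
  have "hyp_const M' d' \<le> 1 * hyp_const M d"
  proof (rule hyp_const_le_scaled[where base = w and K = K])
    show "w \<in> M'" "d' w w = 0" using w M_sub d'_refl by blast+
    fix S1 S2 S3 assume "geodesic_triangle M' d' S1 S2 S3"
    then obtain x y z where xyz: "x \<in> M'" "y \<in> M'" "z \<in> M'" and
      g: "geodesic_segment M' d' x y S1" "geodesic_segment M' d' y z S2" "geodesic_segment M' d' z x S3"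
      by (rule geodesic_triangleE)
    have "geodesic_triangle M d (\<rho> ` S1) (\<rho> ` S2) (\<rho> ` S3)"
      by (rule geodesic_triangleI[OF xyz[THEN \<rho>_M] geodesic_retract[OF g(1) xyz(1,2)]
            geodesic_retract[OF g(2) xyz(2,3)] geodesic_retract[OF g(3) xyz(3,1)]])
    moreover have "thin_triangle M' d' (1 * \<epsilon>) S1 S2 S3" if "thin_triangle M d \<epsilon> (\<rho> ` S1) (\<rho> ` S2) (\<rho> ` S3)" for \<epsilon>
      using that thin_side[OF xyz g, of \<epsilon>] thin_side[OF xyz(2,3,1) g(2,3,1), of \<epsilon>]
        thin_side[OF xyz(3,1,2) g(3,1,2), of \<epsilon>]
      unfolding thin_triangle_def by simp
    ultimately show "\<exists>T1 T2 T3. geodesic_triangle M d T1 T2 T3 \<and>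
         (\<forall>\<epsilon>. thin_triangle M d \<epsilon> T1 T2 T3 \<longrightarrow> thin_triangle M' d' (1 * \<epsilon>) S1 S2 S3)" by blast
  qed (simp_all add: d_nonneg d_bound)
  then show ?thesis by simp
qed

end

text \<open>A triangle of \<open>M\<close> is a triangle of \<open>M'\<close>, and thinness only
  involves distances between points of its sides, which both metrics measure alike.\<close>

lemma hyp_const_mono_isometric:
  assumes ne: "base \<in> M" "d base base = 0" and sub: "M \<subseteq> M'"
    and nonneg: "\<And>x y. x \<in> M' \<Longrightarrow> y \<in> M' \<Longrightarrow> 0 \<le> d' x y"
    and bound: "\<And>x y. x \<in> M' \<Longrightarrow> y \<in> M' \<Longrightarrow> d' x y \<le> K"
    and dist: "\<And>x y. x \<in> M \<Longrightarrow> y \<in> M \<Longrightarrow> d' x y = d x y"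
  shows "hyp_const M d \<le> hyp_const M' d'"
proof -
  have "hyp_const M d \<le> 1 * hyp_const M' d'"
  proof (rule hyp_const_le_scaled[where base = base and K = K])
    fix S1 S2 S3 assume "geodesic_triangle M d S1 S2 S3"
    then obtain x y z where xyz: "x \<in> M" "y \<in> M" "z \<in> M" and
      g: "geodesic_segment M d x y S1" "geodesic_segment M d y z S2" "geodesic_segment M d z x S3"
      by (rule geodesic_triangleE)
    have seg: "geodesic_segment M' d' a b S" if "geodesic_segment M d a b S" "a \<in> M" "b \<in> M" for a b S
      using geodesic_segment_scale[OF that, of 1 id M' d'] sub dist by simp
    have "geodesic_triangle M' d' S1 S2 S3"
      by (rule geodesic_triangleI[OF xyz[THEN subsetD[OF sub]] seg[OF g(1) xyz(1,2)]
            seg[OF g(2) xyz(2,3)] seg[OF g(3) xyz(3,1)]])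
    moreover have "thin_triangle M d (1 * \<epsilon>) S1 S2 S3" if thin: "thin_triangle M' d' \<epsilon> S1 S2 S3" for \<epsilon>
    proof -
      note S = g[THEN geodesic_segment_subset]
      have *: "A \<subseteq> nbhd M d \<epsilon> B" if AB: "A \<subseteq> nbhd M' d' \<epsilon> B" "A \<subseteq> M" "B \<subseteq> M" for A B
      proof
        fix p assume "p \<in> A"
        then obtain q where "q \<in> B" "d' p q \<le> \<epsilon>" using AB(1) unfolding nbhd_def by blast
        then show "p \<in> nbhd M d \<epsilon> B"
          using AB(2,3) \<open>p \<in> A\<close> dist[of p q] unfolding nbhd_def by (auto simp: subset_iff)
      qed
      show ?thesis using thin *[of _ "_ \<union> _"] S unfolding thin_triangle_def by simp
    qed
    ultimately show "\<exists>T1 T2 T3. geodesic_triangle M' d' T1 T2 T3 \<and>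
         (\<forall>\<epsilon>. thin_triangle M' d' \<epsilon> T1 T2 T3 \<longrightarrow> thin_triangle M d (1 * \<epsilon>) S1 S2 S3)" by blast
  qed (simp_all add: ne nonneg bound)
  then show ?thesis by simp
qed

section \<open>Attaching a pendant vertex to a graph\<close>

definition add_pendant :: "'a \<Rightarrow> 'a \<Rightarrow> 'a sgraph \<Rightarrow> 'a sgraph" where
  "add_pendant w z G = \<lparr>verts = insert z (verts G), edges = insert {w, z} (edges G)\<rparr>"

locale pendant_edge = metric_graph G for G :: "'a sgraph" +
  fixes w z :: 'a
  assumes w: "w \<in> verts G" and z: "z \<notin> verts G"
begin

abbreviation "H \<equiv> add_pendant w z G"

lemma verts_H: "verts H = insert z (verts G)" and edges_H: "edges H = insert {w, z} (edges G)"
  by (simp_all add: add_pendant_def)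

lemma wz: "w \<noteq> z"
  using w z by blast

lemma edge_not_z: "e \<in> edges G \<Longrightarrow> z \<notin> e"
  using edge_subset z by blast

lemma metric_graph_H: "metric_graph H"
proof
  show "simple_graph H"
    using simple w wz unfolding simple_graph_def verts_H edges_H by blast
  let ?R = "{(a, b). {a, b} \<in> edges H}"
  have sub: "{(a, b). {a, b} \<in> edges G}\<^sup>* \<subseteq> ?R\<^sup>*" by (rule rtrancl_mono) (auto simp: edges_H)
  have G: "(u, v) \<in> ?R\<^sup>*" if "u \<in> verts G" "v \<in> verts G" for u v
    using that connected sub unfolding connected_graph_def by blast
  have wz': "(w, z) \<in> ?R" "(z, w) \<in> ?R" by (auto simp: edges_H insert_commute)
  have "(u, w) \<in> ?R\<^sup>* \<and> (w, u) \<in> ?R\<^sup>*" if "u \<in> verts H" for u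
    using that G[OF _ w] G[OF w] wz' unfolding verts_H by blast
  then show "connected_graph H"
    unfolding connected_graph_def by (auto simp: verts_H intro: rtrancl_trans)
qed

sublocale H: metric_graph H by (rule metric_graph_H)

lemma card_verts_H: "card (verts H) = Suc (card (verts G))"
  using z by (simp add: verts_H)

text \<open>The new vertex has \<open>w\<close> as its only neighbour, so a cycle through it would
  backtrack.\<close>

lemma cycle_lengths_H: "cycle_lengths H = cycle_lengths G"
proof (intro equalityI subsetI)
  fix L assume "L \<in> cycle_lengths G"
  then obtain v where v: "cyclic_walk G L v" unfolding cycle_lengths_iff ..
  then have "cyclic_walk H L v" unfolding cyclic_walk_def edges_H by simp
  then show "L \<in> cycle_lengths H" unfolding cycle_lengths_iff by (rule exI[of _ v])
next
  fix L assume "L \<in> cycle_lengths H"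
  then obtain v where v: "cyclic_walk H L v" unfolding cycle_lengths_iff ..
  have nbr: "u = w" if "{u, z} \<in> edges H" for u
    using that edge_not_z[of "{u, z}"] wz unfolding edges_H by (auto simp: doubleton_eq_iff)
  have "v m \<noteq> z" for m
  proof
    assume m: "v m = z"
    have L: "3 \<le> L" by (rule cyclic_walkD(1)[OF v])
    \<comment> \<open>The predecessor of \<open>m\<close> modulo \<open>L\<close>, shifted by a
      period to stay meaningful for \<open>m = 0\<close>.\<close>
    define a where "a = m + L - 1"
    have "Suc a = m + L" using L by (simp add: a_def)
    then have "v (Suc a) = v m" by (simp add: cyclic_walkD(3)[OF v])
    then have "v (Suc a) = z" using m by simp
    then have "v a = w" "v (Suc (Suc a)) = w"
      using cyclic_walkD(2)[OF v, of a] cyclic_walkD(2)[OF v, of "Suc a"]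
      by (auto intro!: nbr simp: insert_commute)
    then show False using cyclic_walk_no_backtracking[OF v, of a] by simp
  qed
  then have "{v i, v (Suc i)} \<in> edges G" for i
    using cyclic_walkD(2)[OF v, of i] unfolding edges_H by (metis insertE insertI1 insert_commute singletonD)
  then have "cyclic_walk G L v" using v unfolding cyclic_walk_def by blast
  then show "L \<in> cycle_lengths G" unfolding cycle_lengths_iff by (rule exI[of _ v])
qed

text \<open>Moving the weight of \<open>z\<close> to \<open>w\<close> fixes all points of
  \<open>G\<close> and collapses the new edge. The coordinate at \<open>z\<close> serves as the
  height.\<close>

definition retract :: "('a \<Rightarrow> real) \<Rightarrow> 'a \<Rightarrow> real" where
  "retract p = p(z := 0, w := p w + p z)"

lemma points_H: "points H = points G \<union> ept w z ` {0..1}"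
proof -
  have "cell {z} \<subseteq> cell {w, z}" using ept_in_cell[OF wz, of 1] wz by (simp add: cell_singleton)
  then have "points H = points G \<union> cell {w, z}" unfolding points_def verts_H edges_H by auto
  then show ?thesis by (simp add: cell_edge[OF wz])
qed

lemma retract_points: "p \<in> points G \<Longrightarrow> retract p = p"
  using points_outside[of p z] z by (auto simp: retract_def)

lemma retract_ept [simp]: "retract (ept w z t) = vpt w"
  using wz by (auto simp: retract_def ept_def vpt_def)

lemma vpt_w: "vpt w \<in> points G"
  by (rule vpt_points[OF w])

lemma retract_in: "p \<in> points H \<Longrightarrow> retract p \<in> points G"
  using retract_points vpt_w by (auto simp: points_H)

lemma points_z: "p \<in> points G \<Longrightarrow> p z = 0"
  using points_outside z by blast

lemma ept_z: "ept w z t z = t"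
  by (rule ept_apply(1)[OF wz])

lemma seg_length_H: "p \<in> points G \<Longrightarrow> q \<in> points G \<Longrightarrow> seg_length H p q = seg_length G p q"
  using z points_z[of p] points_z[of q] by (simp add: seg_length_def verts_H)

lemma edge_wz: "{w, z} \<in> edges H"
  by (simp add: edges_H)

lemma points_G_sub: "points G \<subseteq> points H"
  by (simp add: points_H)

lemma gdist_le_H: "p \<in> points G \<Longrightarrow> q \<in> points G \<Longrightarrow> gdist H p q \<le> gdist G p q"
proof (rule gdist_greatest)
  fix e p q assume e: "e \<in> edges G" "p \<in> cell e" "q \<in> cell e"
  then have "gdist H p q \<le> seg_length H p q" by (intro H.gdist_le_seg) (auto simp: edges_H)
  also have "\<dots> = seg_length G p q" using e cell_subset_points by (intro seg_length_H) blast+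
  finally show "gdist H p q \<le> seg_length G p q" .
qed (use points_G_sub H.gdist_triangle in \<open>auto simp: subset_iff\<close>)

text \<open>The upper bound comes from passing through \<open>w\<close>. For the lower bound, the
  right-hand side is a pseudometric bounded by the segment lengths of \<open>H\<close>, so the path
  metric dominates it.\<close>

lemma gdist_H:
  assumes pq: "p \<in> points H" "q \<in> points H"
  shows "gdist H p q = \<bar>p z - q z\<bar> + gdist G (retract p) (retract q)"
proof (rule antisym)
  let ?D = "\<lambda>p q. \<bar>p z - q z\<bar> + gdist G (retract p) (retract q)"
  have up: "gdist H (ept w z t) p \<le> t + gdist G (vpt w) p" if "t \<in> {0..1}" "p \<in> points G" for t p
  proof -
    have "gdist H (ept w z t) (ept w z 0) \<le> t" using H.gdist_ept_le[OF edge_wz that(1), of 0] that(1) by simp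
    moreover have "gdist H (vpt w) p \<le> gdist G (vpt w) p" by (rule gdist_le_H[OF vpt_w that(2)])
    moreover have "gdist H (ept w z t) p \<le> gdist H (ept w z t) (vpt w) + gdist H (vpt w) p"
      using that vpt_w by (intro H.gdist_triangle) (auto simp: points_H)
    ultimately show ?thesis by simp
  qed
  consider "p \<in> points G" "q \<in> points G" | t where "t \<in> {0..1}" "p = ept w z t" "q \<in> points G"
    | t where "t \<in> {0..1}" "q = ept w z t" "p \<in> points G"
    | s t where "s \<in> {0..1}" "t \<in> {0..1}" "p = ept w z s" "q = ept w z t"
    using pq unfolding points_H by blast
  then show "gdist H p q \<le> ?D p q"
  proof cases
    case 1
    then show ?thesis using gdist_le_H[of p q] by (simp add: retract_points points_z[of p] points_z[of q])
  next
    case 2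
    then show ?thesis using up[of t q] by (simp add: retract_points ept_z points_z[of q])
  next
    case 3
    then show ?thesis using up[of t p] H.gdist_sym[of p q] gdist_sym[of p "vpt w"]
      by (simp add: retract_points ept_z points_z[of p])
  next
    case 4
    then show ?thesis using H.gdist_ept_le[OF edge_wz, of s t] vpt_w by (simp add: ept_z)
  qed
  show "?D p q \<le> gdist H p q"
  proof (rule H.gdist_greatest[OF pq])
    show "?D p p \<le> 0" if "p \<in> points H" for p using that retract_in by simp
    show "?D p s \<le> ?D p q + ?D q s" if "p \<in> points H" "q \<in> points H" "s \<in> points H" for p q s
      using gdist_triangle[OF that[THEN retract_in]] by linarith
    fix e p q assume e: "e \<in> edges H" "p \<in> cell e" "q \<in> cell e"
    then consider "e \<in> edges G" | "e = {w, z}" unfolding edges_H by blast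
    then show "?D p q \<le> seg_length H p q"
    proof cases
      case 1
      then have "p \<in> points G" "q \<in> points G" using e cell_subset_points by blast+
      then show ?thesis using gdist_le_seg[OF 1 e(2,3)] by (simp add: retract_points points_z[of p] points_z[of q] seg_length_H)
    next
      case 2
      then obtain s t where "p = ept w z s" "q = ept w z t" using e(2,3) by (auto simp: cell_edge[OF wz])
      then show ?thesis using vpt_w by (simp add: ept_z H.seg_length_ept[OF edge_wz])
    qed
  qed
qed

lemma graph_delta_H: "graph_delta H = graph_delta G"
proof (rule antisym)
  obtain K where K: "\<And>p q. p \<in> points G \<Longrightarrow> q \<in> points G \<Longrightarrow> gdist G p q \<le> K"
    using gdist_bounded by blast
  interpret pendant_space "points G" "points H" "gdist G" "gdist H" "\<lambda>p. p z" retract "vpt w" K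
  proof
    show "p z = 0 \<or> retract p = vpt w" if "p \<in> points H" for p
      using that points_z by (auto simp: points_H)
    show "retract p = p" if "p \<in> points H" "p z = 0" for p
      using that retract_points[of p] retract_ept[of 0] by (auto simp: points_H ept_z simp del: retract_ept)
    \<comment> \<open>Both summands of the distance formula vanish, and \<open>gdist\<close>
      separates points of \<open>H\<close>.\<close>
    show "p = q" if "p \<in> points H" "q \<in> points H" "p z = q z" "retract p = retract q" for p q
      using that H.gdist_eq_0[OF that(1,2)] gdist_H[OF that(1,2)] retract_in by simp
  qed (use gdist_nonneg gdist_triangle gdist_eq_0 K vpt_w points_G_sub retract_in gdist_H H.points_nonneg points_z
      in \<open>auto simp: gdist_sym\<close>)
  show "graph_delta H \<le> graph_delta G" unfolding graph_delta_def by (rule hyp_const_le_retract)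
  obtain K' where K': "\<And>p q. p \<in> points H \<Longrightarrow> q \<in> points H \<Longrightarrow> gdist H p q \<le> K'"
    using H.gdist_bounded by blast
  show "graph_delta G \<le> graph_delta H"
    unfolding graph_delta_def
  proof (rule hyp_const_mono_isometric[where base = "vpt w" and K = K'])
    show "gdist H p q = gdist G p q" if "p \<in> points G" "q \<in> points G" for p q
      using gdist_H[of p q] that points_G_sub points_z[of p] points_z[of q] by (auto simp: retract_points)
  qed (use vpt_w points_G_sub H.gdist_nonneg K' in auto)
qed

end

subsection \<open>The classes of graphs\<close>

text \<open>For an acyclic graph both sides fail, since its girth is infinite; otherwise girth and
  circumference are the extreme cycle lengths.\<close>

lemma graph_class_iff:
  "G \<in> graph_class g c n \<longleftrightarrow> metric_graph G \<and> g \<in> cycle_lengths G \<and> c \<in> cycle_lengths G \<and>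
     (\<forall>k\<in>cycle_lengths G. g \<le> k \<and> k \<le> c) \<and> card (verts G) = n"
proof (cases "cycle_lengths G = {}")
  case True
  then show ?thesis by (simp add: graph_class_def girth_eq_iff)
next
  case False
  then show ?thesis
    unfolding graph_class_def metric_graph_def by (auto simp: girth_eq_iff circumference_eq_iff)
qed

lemma graph_class_relabel:
  assumes G: "metric_graph G" "g \<in> cycle_lengths G" "c \<in> cycle_lengths G"
    "\<forall>k\<in>cycle_lengths G. g \<le> k \<and> k \<le> c" and inj: "inj_on f (verts G)"
  shows "relabel f G \<in> graph_class g c (card (verts G))" "graph_delta (relabel f G) = graph_delta G"
proof -
  interpret metric_graph G by fact
  show "relabel f G \<in> graph_class g c (card (verts G))"
    unfolding graph_class_iff cycle_lengths_relabel[OF inj]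
    using G metric_graph_relabel[OF inj] inj by (simp add: relabel_def card_image)
  show "graph_delta (relabel f G) = graph_delta G" by (rule graph_delta_relabel[OF inj])
qed

text \<open>Every member can be relabelled onto \<open>{..<n}\<close> without changing its constant,
  and there are only finitely many graphs on that vertex set. This makes \<open>Min\<close> and
  \<open>Max\<close> true extrema.\<close>

lemma finite_graph_delta_image: "finite (graph_delta ` graph_class g c n)"
proof (rule finite_subset)
  let ?F = "{G :: nat sgraph. verts G \<subseteq> {..<n} \<and> edges G \<subseteq> Pow {..<n}}"
  show "graph_delta ` graph_class g c n \<subseteq> graph_delta ` ?F"
  proof (rule image_subsetI)
    fix G assume "G \<in> graph_class g c n"
    then have G: "metric_graph G" "g \<in> cycle_lengths G" "c \<in> cycle_lengths G"
      "\<forall>k\<in>cycle_lengths G. g \<le> k \<and> k \<le> c" and n: "card (verts G) = n"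
      by (auto simp: graph_class_iff)
    interpret metric_graph G by fact
    obtain f where f: "bij_betw f (verts G) {0..<n}"
      using ex_bij_betw_finite_nat[OF finite_verts] n by blast
    then have inj: "inj_on f (verts G)" and img: "f ` verts G = {..<n}"
      by (auto simp: bij_betw_def atLeast0LessThan)
    have "f ` e \<subseteq> {..<n}" if "e \<in> edges G" for e using edge_subset[OF that] img by blast
    then have "relabel f G \<in> ?F" using img by (auto simp: relabel_def)
    then show "graph_delta G \<in> graph_delta ` ?F"
      using graph_class_relabel(2)[OF G inj] by (metis imageI)
  qed
  have "?F \<subseteq> (\<lambda>(V, E). \<lparr>verts = V, edges = E\<rparr>) ` (Pow {..<n} \<times> Pow (Pow {..<n}))"
  proof
    fix G assume "G \<in> ?F"
    then show "G \<in> (\<lambda>(V, E). \<lparr>verts = V, edges = E\<rparr>) ` (Pow {..<n} \<times> Pow (Pow {..<n}))"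
      by (intro image_eqI[of _ _ "(verts G, edges G)"]) auto
  qed
  then show "finite (graph_delta ` ?F)" by (intro finite_imageI) (rule finite_subset, auto)
qed

lemma graph_class_pad:
  assumes "G \<in> graph_class g c k" "k \<le> n"
  shows "\<exists>G'\<in>graph_class g c n. graph_delta G' = graph_delta G"
  using assms(2)
proof (induction n rule: dec_induct)
  case base
  then show ?case using assms(1) by blast
next
  case (step n)
  then obtain G' where G': "G' \<in> graph_class g c n" "graph_delta G' = graph_delta G" by blast
  then interpret metric_graph G' by (simp add: graph_class_iff)
  obtain w where w: "w \<in> verts G'" using connected unfolding connected_graph_def by blast
  obtain z where z: "z \<notin> verts G'" using ex_new_if_finite[OF infinite_UNIV_nat finite_verts] by blast
  interpret pendant_edge G' w z by unfold_locales (fact w z)+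
  have "H \<in> graph_class g c (Suc n)"
    using G'(1) metric_graph_H card_verts_H by (simp add: graph_class_iff cycle_lengths_H)
  then show ?case using graph_delta_H G'(2) by (intro bexI[of _ H]) simp_all
qed

text \<open>Finite girth supplies a cycle, hence the edge that the subdivision requires. The finite
  vertex set of the subdivision is injected into the naturals to land in the class, and pendant
  vertices raise the order to \<open>N\<close>.\<close>

lemma graph_class_subdivide:
  assumes G: "G \<in> graph_class g c n" and r: "0 < r" and N: "n + (r - 1) * card (edges G) \<le> N"
  shows "\<exists>G'\<in>graph_class (r * g) (r * c) N. graph_delta G' = real r * graph_delta G"
proof -
  interpret metric_graph G using G by (simp add: graph_class_iff)
  obtain w where "cyclic_walk G g w" using G unfolding graph_class_iff cycle_lengths_iff by blast
  then have "edges G \<noteq> {}" using cyclic_walkD(2) by blast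
  then interpret subdivision G r using r by unfold_locales
  obtain f :: "(nat \<Rightarrow> real) \<Rightarrow> nat" where f: "inj_on f (verts H)"
    using finite_imp_inj_to_nat_seg[OF finite_verts_H] by blast
  have C: "r * g \<in> cycle_lengths H" "r * c \<in> cycle_lengths H"
    "\<forall>k\<in>cycle_lengths H. r * g \<le> k \<and> k \<le> r * c"
    using G by (auto simp: graph_class_iff cycle_lengths_subdivide)
  note G' = graph_class_relabel[OF metric_graph_H C f]
  have "card (verts H) \<le> N"
    using card_verts_subdivide[OF subdivision_axioms] G N by (simp add: graph_class_iff)
  from graph_class_pad[OF G'(1) this] show ?thesis
    using G'(2) graph_delta_subdivide by simp
qed

text \<open>The subdivided and padded extremal graphs are competitors in the two target classes, so
  their constants lie above the minimum and below the maximum there. The middle inequality holds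
  because \<open>G1\<close> itself competes for the maximum.\<close>

theorem theorem2p15:
  fixes g c n r m1 m2 n1 n2 :: nat and G1 G2 :: "nat sgraph"
  assumes "v_admissible g c n"
    and "3 \<le> g" and "g \<le> c" and "c \<le> n"
    and "0 < r"
    and "G1 \<in> graph_class g c n" and "G2 \<in> graph_class g c n"
    and "card (edges G1) = m1" and "card (edges G2) = m2"
    and "graph_delta G1 = min_delta g c n"
    and "graph_delta G2 = max_delta g c n"
    and "n1 \<ge> n + (r - 1) * m1"
    and "n2 \<ge> n + (r - 1) * m2"
  shows "min_delta (r * g) (r * c) n1 \<le> real r * min_delta g c n \<and>
         real r * min_delta g c n \<le> real r * max_delta g c n \<and>
         real r * max_delta g c n \<le> max_delta (r * g) (r * c) n2"
proof (intro conjI)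
  obtain G1' where "G1' \<in> graph_class (r * g) (r * c) n1" "graph_delta G1' = real r * graph_delta G1"
    using graph_class_subdivide[OF assms(6,5)] assms(8,12) by blast
  then show "min_delta (r * g) (r * c) n1 \<le> real r * min_delta g c n"
    unfolding min_delta_def[of "r * g"] assms(10)[symmetric]
    by (metis Min_le finite_graph_delta_image imageI)
  obtain G2' where "G2' \<in> graph_class (r * g) (r * c) n2" "graph_delta G2' = real r * graph_delta G2"
    using graph_class_subdivide[OF assms(7,5)] assms(9,13) by blast
  then show "real r * max_delta g c n \<le> max_delta (r * g) (r * c) n2"
    unfolding max_delta_def[of "r * g"] assms(11)[symmetric]
    by (metis Max_ge finite_graph_delta_image imageI)
  have "min_delta g c n \<le> max_delta g c n"
    unfolding max_delta_def assms(10)[symmetric]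
    using assms(6) by (intro Max_ge finite_graph_delta_image imageI)
  then show "real r * min_delta g c n \<le> real r * max_delta g c n" by (rule mult_left_mono) simp
qed

end
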